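(* Let $\mathcal{C}$ and $\mathcal{D}$ be pivotal fusion categories over $\mathbb{C}$. If $\mathcal{C}$ and $\mathcal{D}$ are equivalent as ($\mathbb{C}$-linear) monoidal categories (the equivalence is not assumed to preserve the pivotal structures), then $\nu_n(\mathcal{C}) = \nu_n(\mathcal{D})$ for every integer $n \ge 1$.
   Context: Everything is over $\mathbb{C}$; functors between $\mathbb{C}$-linear categories are $\mathbb{C}$-linear. A fusion category is a $\mathbb{C}$-linear semisimple rigid monoidal category with finite-dimensional Hom-spaces and finitely many isomorphism classes of simple objects, whose unit object $\mathbf{1}$ is simple (taken strictly unital) and with $\mathrm{End}(V) \cong \mathbb{C}$ for every simple $V$. $\mathrm{Irr}(\mathcal{C})$ is a set of representatives of isomorphism classes of simple objects. $V^*$ denotes the left dual of $V$ with duality morphisms $b_V: \mathbf{1} \to V \otimes V^*$, $d_V: V^* \otimes V \to \mathbf{1}$; $a$ denotes the associativity isomorphism $a_{X,Y,Z}:(X\otimes Y)\otimes Z\to X\otimes(Y\otimes Z)$. A pivotal structure is an isomorphism of monoidal functors $j: \mathrm{id}_{\mathcal{C}} \to (-)^{**}$; a pivotal fusion category is a fusion category equipped with one. The pivotal dimension is $\mathrm{pdim}(V) = d_{V^*} \circ (j_V \otimes \mathrm{id}_{V^*}) \circ b_V \in \mathrm{End}(\mathbf{1}) = \mathbb{C}$. Frobenius-Schur indicators: put $V^{\otimes 0} = \mathbf{1}$, $V^{\otimes 1} = V$, $V^{\otimes n} = V \otimes V^{\otimes (n-1)}$. Let $D_{V,W}: \mathrm{Hom}(\mathbf{1},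 V \otimes W) \to \mathrm{Hom}(\mathbf{1}, W \otimes V^{**})$ be the composite of the duality isomorphisms $\mathrm{Hom}(\mathbf{1}, V \otimes W) \cong \mathrm{Hom}(V^*, W) \cong \mathrm{Hom}(\mathbf{1}, W \otimes V^{**})$, i.e. $D_{V,W}(f) = (\tilde f \otimes \mathrm{id}_{V^{**}}) \circ b_{V^*}$ with $\tilde f = (d_V \otimes \mathrm{id}_W) \circ a_{V^*,V,W}^{-1} \circ (\mathrm{id}_{V^*} \otimes f)$. For $n \ge 1$ define the linear automorphism $E_V^{(n)}$ of $\mathrm{Hom}(\mathbf{1}, V^{\otimes n})$ by $E_V^{(n)}(f) = a_V^{(n)} \circ (\mathrm{id}_{V^{\otimes (n-1)}} \otimes j_V^{-1}) \circ D_{V, V^{\otimes (n-1)}}(f)$, where $a_V^{(n)}: V^{\otimes(n-1)} \otimes V \to V^{\otimes n}$ is the canonical isomorphism built from associators. The $n$-th Frobenius-Schur indicator of $V$ is $\nu_n(V) = \mathrm{Tr}(E_V^{(n)})$. For a pivotal fusion category, $\nu_n(\mathcal{C}) := \sum_{V \in \mathrm{Irr}(\mathcal{C})} \nu_n(V)\, \mathrm{pdim}(V)$. *)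

theory Defs
  imports Complex_Main "Jordan_Normal_Form.VS_Connect"
begin

section \<open>Complex-linear categories\<close>

text \<open>
  A small category with object set \<open>Ob\<close> and morphism set \<open>Mor\<close>.  Every morphism determines its
  source and target, so different Hom-sets are disjoint and each Hom-space has its own zero
  morphism.  The linear operations \<open>madd\<close> and \<open>mscale\<close> are only meaningful inside one Hom-space.
\<close>

record ('o, 'm) lin_cat =
  Ob :: "'o set"
  Mor :: "'m set"
  Dom :: "'m \<Rightarrow> 'o"
  Cod :: "'m \<Rightarrow> 'o"
  idt :: "'o \<Rightarrow> 'm"  ("\<iota>\<index>")
  cmp :: "'m \<Rightarrow> 'm \<Rightarrow> 'm"  (infixr "\<cdot>\<index>" 70)
  mzero :: "'o \<Rightarrow> 'o \<Rightarrow> 'm"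
  madd :: "'m \<Rightarrow> 'm \<Rightarrow> 'm"
  mscale :: "complex \<Rightarrow> 'm \<Rightarrow> 'm"

definition Hom :: "('o, 'm, 'z) lin_cat_scheme \<Rightarrow> 'o \<Rightarrow> 'o \<Rightarrow> 'm set" where
  "Hom C X Y = {f \<in> Mor C. Dom C f = X \<and> Cod C f = Y}"

text \<open>
  The Hom-space as a module record over the field \<^term>\<open>class_ring :: complex ring\<close>.  The
  multiplicative components of the record play no role in the theory of modules.
\<close>

definition hom_space :: "('o, 'm, 'z) lin_cat_scheme \<Rightarrow> 'o \<Rightarrow> 'o \<Rightarrow> (complex, 'm) module" where
  "hom_space C X Y = \<lparr>carrier = Hom C X Y, mult = undefined, one = undefined,
     zero = mzero C X Y, add = madd C, smult = mscale C\<rparr>"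

abbreviation linear_maps :: "(complex, 'a) module \<Rightarrow> (complex, 'b) module \<Rightarrow> ('a \<Rightarrow> 'b) set" where
  "linear_maps \<equiv> LinearCombinations.module_hom (class_ring :: complex ring)"

locale lin_category =
  fixes C :: "('o, 'm, 'z) lin_cat_scheme" (structure)
  assumes Dom_in_Ob: "f \<in> Mor C \<Longrightarrow> Dom C f \<in> Ob C"
    and Cod_in_Ob: "f \<in> Mor C \<Longrightarrow> Cod C f \<in> Ob C"
    and idt_in_Hom: "X \<in> Ob C \<Longrightarrow> \<iota> X \<in> Hom C X X"
    and cmp_in_Hom: "\<lbrakk>f \<in> Hom C X Y; g \<in> Hom C Y Z\<rbrakk> \<Longrightarrow> g \<cdot> f \<in> Hom C X Z"
    and cmp_idt_right: "f \<in> Hom C X Y \<Longrightarrow> f \<cdot> \<iota> X = f"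
    and cmp_idt_left: "f \<in> Hom C X Y \<Longrightarrow> \<iota> Y \<cdot> f = f"
    and cmp_assoc: "\<lbrakk>f \<in> Hom C W X; g \<in> Hom C X Y; h \<in> Hom C Y Z\<rbrakk> \<Longrightarrow> (h \<cdot> g) \<cdot> f = h \<cdot> (g \<cdot> f)"
    and hom_vectorspace:
      "\<lbrakk>X \<in> Ob C; Y \<in> Ob C\<rbrakk> \<Longrightarrow> vectorspace (class_ring :: complex ring) (hom_space C X Y)"
    and cmp_linear_right: "\<lbrakk>X \<in> Ob C; g \<in> Hom C Y Z\<rbrakk> \<Longrightarrow>
      (\<lambda>f. g \<cdot> f) \<in> linear_maps (hom_space C X Y) (hom_space C X Z)"
    and cmp_linear_left: "\<lbrakk>f \<in> Hom C X Y; Z \<in> Ob C\<rbrakk> \<Longrightarrow>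
      (\<lambda>g. g \<cdot> f) \<in> linear_maps (hom_space C Y Z) (hom_space C X Z)"

definition mutually_inverse :: "('o, 'm, 'z) lin_cat_scheme \<Rightarrow> 'm \<Rightarrow> 'm \<Rightarrow> bool" where
  "mutually_inverse C f g \<longleftrightarrow> f \<in> Mor C \<and> g \<in> Hom C (Cod C f) (Dom C f) \<and>
     g \<cdot>\<^bsub>C\<^esub> f = \<iota>\<^bsub>C\<^esub> (Dom C f) \<and> f \<cdot>\<^bsub>C\<^esub> g = \<iota>\<^bsub>C\<^esub> (Cod C f)"

definition iso_mor :: "('o, 'm, 'z) lin_cat_scheme \<Rightarrow> 'm \<Rightarrow> bool" where
  "iso_mor C f \<longleftrightarrow> (\<exists>g. mutually_inverse C f g)"

definition minv :: "('o, 'm, 'z) lin_cat_scheme \<Rightarrow> 'm \<Rightarrow> 'm" where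
  "minv C f = (THE g. mutually_inverse C f g)"

definition isomorphic :: "('o, 'm, 'z) lin_cat_scheme \<Rightarrow> 'o \<Rightarrow> 'o \<Rightarrow> bool" where
  "isomorphic C X Y \<longleftrightarrow> (\<exists>f \<in> Hom C X Y. iso_mor C f)"


section \<open>Abelian and semisimple categories\<close>

definition is_mono :: "('o, 'm, 'z) lin_cat_scheme \<Rightarrow> 'm \<Rightarrow> bool" where
  "is_mono C f \<longleftrightarrow> f \<in> Mor C \<and>
     (\<forall>W. \<forall>g \<in> Hom C W (Dom C f). \<forall>h \<in> Hom C W (Dom C f). f \<cdot>\<^bsub>C\<^esub> g = f \<cdot>\<^bsub>C\<^esub> h \<longrightarrow> g = h)"

definition is_epi :: "('o, 'm, 'z) lin_cat_scheme \<Rightarrow> 'm \<Rightarrow> bool" where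
  "is_epi C f \<longleftrightarrow> f \<in> Mor C \<and>
     (\<forall>W. \<forall>g \<in> Hom C (Cod C f) W. \<forall>h \<in> Hom C (Cod C f) W. g \<cdot>\<^bsub>C\<^esub> f = h \<cdot>\<^bsub>C\<^esub> f \<longrightarrow> g = h)"

definition is_kernel :: "('o, 'm, 'z) lin_cat_scheme \<Rightarrow> 'm \<Rightarrow> 'm \<Rightarrow> bool" where
  "is_kernel C k f \<longleftrightarrow> f \<in> Mor C \<and> k \<in> Hom C (Dom C k) (Dom C f) \<and>
     f \<cdot>\<^bsub>C\<^esub> k = mzero C (Dom C k) (Cod C f) \<and>
     (\<forall>W. \<forall>g \<in> Hom C W (Dom C f). f \<cdot>\<^bsub>C\<^esub> g = mzero C W (Cod C f) \<longrightarrow>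
        (\<exists>!h. h \<in> Hom C W (Dom C k) \<and> k \<cdot>\<^bsub>C\<^esub> h = g))"

definition is_cokernel :: "('o, 'm, 'z) lin_cat_scheme \<Rightarrow> 'm \<Rightarrow> 'm \<Rightarrow> bool" where
  "is_cokernel C q f \<longleftrightarrow> f \<in> Mor C \<and> q \<in> Hom C (Cod C f) (Cod C q) \<and>
     q \<cdot>\<^bsub>C\<^esub> f = mzero C (Dom C f) (Cod C q) \<and>
     (\<forall>W. \<forall>g \<in> Hom C (Cod C f) W. g \<cdot>\<^bsub>C\<^esub> f = mzero C (Dom C f) W \<longrightarrow>
        (\<exists>!h. h \<in> Hom C (Cod C q) W \<and> h \<cdot>\<^bsub>C\<^esub> q = g))"

text \<open>\<open>X\<close> is the direct sum of \<open>S 0, \<dots>, S (n - 1)\<close>; for \<open>n = 0\<close> this says that \<open>X\<close> is a zero object.\<close>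

definition is_direct_sum ::
  "('o, 'm, 'z) lin_cat_scheme \<Rightarrow> 'o \<Rightarrow> nat \<Rightarrow> (nat \<Rightarrow> 'o) \<Rightarrow> (nat \<Rightarrow> 'm) \<Rightarrow> (nat \<Rightarrow> 'm) \<Rightarrow> bool" where
  "is_direct_sum C X n S inc prj \<longleftrightarrow> X \<in> Ob C \<and>
     (\<forall>i<n. S i \<in> Ob C \<and> inc i \<in> Hom C (S i) X \<and> prj i \<in> Hom C X (S i)) \<and>
     (\<forall>i<n. \<forall>j<n. prj i \<cdot>\<^bsub>C\<^esub> inc j = (if i = j then \<iota>\<^bsub>C\<^esub> (S i) else mzero C (S j) (S i))) \<and>
     finsum (hom_space C X X) (\<lambda>i. inc i \<cdot>\<^bsub>C\<^esub> prj i) {..<n} = \<iota>\<^bsub>C\<^esub> X"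

locale abelian_category = lin_category +
  assumes direct_sums: "(\<And>i. i < n \<Longrightarrow> S i \<in> Ob C) \<Longrightarrow> \<exists>X inc prj. is_direct_sum C X n S inc prj"
    and kernels: "f \<in> Mor C \<Longrightarrow> \<exists>k. is_kernel C k f"
    and cokernels: "f \<in> Mor C \<Longrightarrow> \<exists>q. is_cokernel C q f"
    and mono_normal: "is_mono C f \<Longrightarrow> \<exists>g. is_kernel C f g"
    and epi_normal: "is_epi C f \<Longrightarrow> \<exists>g. is_cokernel C f g"

text \<open>A simple object is a nonzero object without proper nonzero subobjects.\<close>

definition is_simple :: "('o, 'm, 'z) lin_cat_scheme \<Rightarrow> 'o \<Rightarrow> bool" where
  "is_simple C X \<longleftrightarrow> X \<in> Ob C \<and> \<iota>\<^bsub>C\<^esub> X \<noteq> mzero C X X \<and>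
     (\<forall>Y. \<forall>i \<in> Hom C Y X. is_mono C i \<longrightarrow> i = mzero C Y X \<or> iso_mor C i)"

locale semisimple_category = abelian_category +
  assumes semisimple:
    "X \<in> Ob C \<Longrightarrow> \<exists>n S inc prj. is_direct_sum C X n S inc prj \<and> (\<forall>i<n. is_simple C (S i))"

definition irr_representatives :: "('o, 'm, 'z) lin_cat_scheme \<Rightarrow> 'o set \<Rightarrow> bool" where
  "irr_representatives C I \<longleftrightarrow> (\<forall>V \<in> I. is_simple C V) \<and>
     (\<forall>V. is_simple C V \<longrightarrow> (\<exists>!W. W \<in> I \<and> isomorphic C V W))"


section \<open>Monoidal categories\<close>

record ('o, 'm) mon_cat = "('o, 'm) lin_cat" +
  unit :: "'o"  ("\<^bold>1\<index>")
  tens_ob :: "'o \<Rightarrow> 'o \<Rightarrow> 'o"  (infixr "\<otimes>\<^sub>o\<index>" 80)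
  tens_mor :: "'m \<Rightarrow> 'm \<Rightarrow> 'm"  (infixr "\<otimes>\<^sub>m\<index>" 80)
  assoc :: "'o \<Rightarrow> 'o \<Rightarrow> 'o \<Rightarrow> 'm"  ("\<a>\<index>")

text \<open>
  The unit object is strict: the unit constraints are identities, and the triangle axiom therefore
  reads \<open>\<a> X \<^bold>1 Y = \<iota> (X \<otimes>\<^sub>o Y)\<close>.
\<close>

locale lin_monoidal_category = lin_category C
  for C :: "('o, 'm, 'z) mon_cat_scheme" (structure) +
  assumes unit_in_Ob: "\<^bold>1 \<in> Ob C"
    and tens_in_Ob: "\<lbrakk>X \<in> Ob C; Y \<in> Ob C\<rbrakk> \<Longrightarrow> X \<otimes>\<^sub>o Y \<in> Ob C"
    and tens_linear_left: "\<lbrakk>X \<in> Ob C; Y \<in> Ob C; g \<in> Hom C X' Y'\<rbrakk> \<Longrightarrow>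
      (\<lambda>f. f \<otimes>\<^sub>m g) \<in> linear_maps (hom_space C X Y) (hom_space C (X \<otimes>\<^sub>o X') (Y \<otimes>\<^sub>o Y'))"
    and tens_linear_right: "\<lbrakk>f \<in> Hom C X Y; X' \<in> Ob C; Y' \<in> Ob C\<rbrakk> \<Longrightarrow>
      (\<lambda>g. f \<otimes>\<^sub>m g) \<in> linear_maps (hom_space C X' Y') (hom_space C (X \<otimes>\<^sub>o X') (Y \<otimes>\<^sub>o Y'))"
    and tens_idt: "\<lbrakk>X \<in> Ob C; Y \<in> Ob C\<rbrakk> \<Longrightarrow> \<iota> X \<otimes>\<^sub>m \<iota> Y = \<iota> (X \<otimes>\<^sub>o Y)"
    and tens_cmp: "\<lbrakk>f \<in> Hom C X Y; g \<in> Hom C Y Z; f' \<in> Hom C X' Y'; g' \<in> Hom C Y' Z'\<rbrakk> \<Longrightarrow>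
      (g \<cdot> f) \<otimes>\<^sub>m (g' \<cdot> f') = (g \<otimes>\<^sub>m g') \<cdot> (f \<otimes>\<^sub>m f')"
    and assoc_in_Hom: "\<lbrakk>X \<in> Ob C; Y \<in> Ob C; Z \<in> Ob C\<rbrakk> \<Longrightarrow>
      \<a> X Y Z \<in> Hom C ((X \<otimes>\<^sub>o Y) \<otimes>\<^sub>o Z) (X \<otimes>\<^sub>o (Y \<otimes>\<^sub>o Z))"
    and assoc_iso: "\<lbrakk>X \<in> Ob C; Y \<in> Ob C; Z \<in> Ob C\<rbrakk> \<Longrightarrow> iso_mor C (\<a> X Y Z)"
    and assoc_natural: "\<lbrakk>f \<in> Hom C X X'; g \<in> Hom C Y Y'; h \<in> Hom C Z Z'\<rbrakk> \<Longrightarrow>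
      \<a> X' Y' Z' \<cdot> ((f \<otimes>\<^sub>m g) \<otimes>\<^sub>m h) = (f \<otimes>\<^sub>m (g \<otimes>\<^sub>m h)) \<cdot> \<a> X Y Z"
    and pentagon: "\<lbrakk>W \<in> Ob C; X \<in> Ob C; Y \<in> Ob C; Z \<in> Ob C\<rbrakk> \<Longrightarrow>
      \<a> W X (Y \<otimes>\<^sub>o Z) \<cdot> \<a> (W \<otimes>\<^sub>o X) Y Z
        = (\<iota> W \<otimes>\<^sub>m \<a> X Y Z) \<cdot> \<a> W (X \<otimes>\<^sub>o Y) Z \<cdot> (\<a> W X Y \<otimes>\<^sub>m \<iota> Z)"
    and unit_ob_left: "X \<in> Ob C \<Longrightarrow> \<^bold>1 \<otimes>\<^sub>o X = X"
    and unit_ob_right: "X \<in> Ob C \<Longrightarrow> X \<otimes>\<^sub>o \<^bold>1 = X"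
    and unit_mor_left: "f \<in> Mor C \<Longrightarrow> \<iota> \<^bold>1 \<otimes>\<^sub>m f = f"
    and unit_mor_right: "f \<in> Mor C \<Longrightarrow> f \<otimes>\<^sub>m \<iota> \<^bold>1 = f"
    and triangle: "\<lbrakk>X \<in> Ob C; Y \<in> Ob C\<rbrakk> \<Longrightarrow> \<a> X \<^bold>1 Y = \<iota> (X \<otimes>\<^sub>o Y)"

text \<open>\<open>is_left_dual C X Y d b\<close>: the object \<open>Y\<close> with \<open>d : Y \<otimes> X \<rightarrow> 1\<close> and \<open>b : 1 \<rightarrow> X \<otimes> Y\<close> is a left dual of \<open>X\<close>.\<close>

definition is_left_dual ::
  "('o, 'm, 'z) mon_cat_scheme \<Rightarrow> 'o \<Rightarrow> 'o \<Rightarrow> 'm \<Rightarrow> 'm \<Rightarrow> bool" where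
  "is_left_dual C X Y d b \<longleftrightarrow> X \<in> Ob C \<and> Y \<in> Ob C \<and>
     d \<in> Hom C (Y \<otimes>\<^sub>o\<^bsub>C\<^esub> X) \<^bold>1\<^bsub>C\<^esub> \<and> b \<in> Hom C \<^bold>1\<^bsub>C\<^esub> (X \<otimes>\<^sub>o\<^bsub>C\<^esub> Y) \<and>
     (\<iota>\<^bsub>C\<^esub> X \<otimes>\<^sub>m\<^bsub>C\<^esub> d) \<cdot>\<^bsub>C\<^esub> \<a>\<^bsub>C\<^esub> X Y X \<cdot>\<^bsub>C\<^esub> (b \<otimes>\<^sub>m\<^bsub>C\<^esub> \<iota>\<^bsub>C\<^esub> X) = \<iota>\<^bsub>C\<^esub> X \<and>
     (d \<otimes>\<^sub>m\<^bsub>C\<^esub> \<iota>\<^bsub>C\<^esub> Y) \<cdot>\<^bsub>C\<^esub> minv C (\<a>\<^bsub>C\<^esub> Y X Y) \<cdot>\<^bsub>C\<^esub> (\<iota>\<^bsub>C\<^esub> Y \<otimes>\<^sub>m\<^bsub>C\<^esub> b) = \<iota>\<^bsub>C\<^esub> Y"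

text \<open>
  Rigidity asks for left and right duals; \<open>Y\<close> is a right dual of \<open>X\<close> iff \<open>X\<close> is a left dual of \<open>Y\<close>.
\<close>

locale fusion_category = lin_monoidal_category C + semisimple_category C
  for C :: "('o, 'm, 'z) mon_cat_scheme" (structure) +
  assumes left_duals: "X \<in> Ob C \<Longrightarrow> \<exists>Y d b. is_left_dual C X Y d b"
    and right_duals: "X \<in> Ob C \<Longrightarrow> \<exists>Y d b. is_left_dual C Y X d b"
    and hom_fin_dim: "\<lbrakk>X \<in> Ob C; Y \<in> Ob C\<rbrakk> \<Longrightarrow>
      vectorspace.fin_dim (class_ring :: complex ring) (hom_space C X Y)"
    and finitely_many_simples:
      "\<exists>I. finite I \<and> (\<forall>V. is_simple C V \<longrightarrow> (\<exists>W \<in> I. isomorphic C V W))"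
    and unit_simple: "is_simple C \<^bold>1"
    and End_simple: "is_simple C V \<Longrightarrow> bij_betw (\<lambda>c. mscale C c (\<iota> V)) UNIV (Hom C V V)"


section \<open>Linear and monoidal functors\<close>

locale lin_functor = source: lin_category C + target: lin_category D
  for C :: "('o, 'm, 'y) lin_cat_scheme" and D :: "('p, 'q, 'z) lin_cat_scheme"
    and Fo :: "'o \<Rightarrow> 'p" and Fm :: "'m \<Rightarrow> 'q" +
  assumes F_in_Ob: "X \<in> Ob C \<Longrightarrow> Fo X \<in> Ob D"
    and F_linear: "\<lbrakk>X \<in> Ob C; Y \<in> Ob C\<rbrakk> \<Longrightarrow>
      Fm \<in> linear_maps (hom_space C X Y) (hom_space D (Fo X) (Fo Y))"
    and F_idt: "X \<in> Ob C \<Longrightarrow> Fm (\<iota>\<^bsub>C\<^esub> X) = \<iota>\<^bsub>D\<^esub> (Fo X)"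
    and F_cmp: "\<lbrakk>f \<in> Hom C X Y; g \<in> Hom C Y Z\<rbrakk> \<Longrightarrow> Fm (g \<cdot>\<^bsub>C\<^esub> f) = Fm g \<cdot>\<^bsub>D\<^esub> Fm f"

definition natural_iso ::
  "('o, 'm, 'y) lin_cat_scheme \<Rightarrow> ('p, 'q, 'z) lin_cat_scheme \<Rightarrow>
   ('o \<Rightarrow> 'p) \<Rightarrow> ('m \<Rightarrow> 'q) \<Rightarrow> ('o \<Rightarrow> 'p) \<Rightarrow> ('m \<Rightarrow> 'q) \<Rightarrow> ('o \<Rightarrow> 'q) \<Rightarrow> bool" where
  "natural_iso C D Fo Fm Go Gm \<eta> \<longleftrightarrow>
     (\<forall>X \<in> Ob C. \<eta> X \<in> Hom D (Fo X) (Go X) \<and> iso_mor D (\<eta> X)) \<and>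
     (\<forall>X Y. \<forall>f \<in> Hom C X Y. \<eta> Y \<cdot>\<^bsub>D\<^esub> Fm f = Gm f \<cdot>\<^bsub>D\<^esub> \<eta> X)"

definition is_equivalence ::
  "('o, 'm, 'y) lin_cat_scheme \<Rightarrow> ('p, 'q, 'z) lin_cat_scheme \<Rightarrow> ('o \<Rightarrow> 'p) \<Rightarrow> ('m \<Rightarrow> 'q) \<Rightarrow> bool" where
  "is_equivalence C D Fo Fm \<longleftrightarrow> lin_functor C D Fo Fm \<and>
     (\<exists>Go Gm \<eta> \<epsilon>. lin_functor D C Go Gm \<and>
        natural_iso C C (Go \<circ> Fo) (Gm \<circ> Fm) id id \<eta> \<and>
        natural_iso D D (Fo \<circ> Go) (Fm \<circ> Gm) id id \<epsilon>)"

locale monoidal_functor = source: lin_monoidal_category C + target: lin_monoidal_category D +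
    lin_functor C D Fo Fm
  for C :: "('o, 'm, 'y) mon_cat_scheme" and D :: "('p, 'q, 'z) mon_cat_scheme"
    and Fo :: "'o \<Rightarrow> 'p" and Fm :: "'m \<Rightarrow> 'q"
    and F2 :: "'o \<Rightarrow> 'o \<Rightarrow> 'q" and F0 :: "'q" +
  assumes F2_in_Hom: "\<lbrakk>X \<in> Ob C; Y \<in> Ob C\<rbrakk> \<Longrightarrow>
      F2 X Y \<in> Hom D (Fo X \<otimes>\<^sub>o\<^bsub>D\<^esub> Fo Y) (Fo (X \<otimes>\<^sub>o\<^bsub>C\<^esub> Y))"
    and F2_iso: "\<lbrakk>X \<in> Ob C; Y \<in> Ob C\<rbrakk> \<Longrightarrow> iso_mor D (F2 X Y)"
    and F2_natural: "\<lbrakk>f \<in> Hom C X X'; g \<in> Hom C Y Y'\<rbrakk> \<Longrightarrow>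
      F2 X' Y' \<cdot>\<^bsub>D\<^esub> (Fm f \<otimes>\<^sub>m\<^bsub>D\<^esub> Fm g) = Fm (f \<otimes>\<^sub>m\<^bsub>C\<^esub> g) \<cdot>\<^bsub>D\<^esub> F2 X Y"
    and F0_in_Hom: "F0 \<in> Hom D \<^bold>1\<^bsub>D\<^esub> (Fo \<^bold>1\<^bsub>C\<^esub>)"
    and F0_iso: "iso_mor D F0"
    and F2_assoc: "\<lbrakk>X \<in> Ob C; Y \<in> Ob C; Z \<in> Ob C\<rbrakk> \<Longrightarrow>
      Fm (\<a>\<^bsub>C\<^esub> X Y Z) \<cdot>\<^bsub>D\<^esub> F2 (X \<otimes>\<^sub>o\<^bsub>C\<^esub> Y) Z \<cdot>\<^bsub>D\<^esub> (F2 X Y \<otimes>\<^sub>m\<^bsub>D\<^esub> \<iota>\<^bsub>D\<^esub> (Fo Z))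
        = F2 X (Y \<otimes>\<^sub>o\<^bsub>C\<^esub> Z) \<cdot>\<^bsub>D\<^esub> (\<iota>\<^bsub>D\<^esub> (Fo X) \<otimes>\<^sub>m\<^bsub>D\<^esub> F2 Y Z) \<cdot>\<^bsub>D\<^esub> \<a>\<^bsub>D\<^esub> (Fo X) (Fo Y) (Fo Z)"
    and F0_left: "X \<in> Ob C \<Longrightarrow> F2 \<^bold>1\<^bsub>C\<^esub> X \<cdot>\<^bsub>D\<^esub> (F0 \<otimes>\<^sub>m\<^bsub>D\<^esub> \<iota>\<^bsub>D\<^esub> (Fo X)) = \<iota>\<^bsub>D\<^esub> (Fo X)"
    and F0_right: "X \<in> Ob C \<Longrightarrow> F2 X \<^bold>1\<^bsub>C\<^esub> \<cdot>\<^bsub>D\<^esub> (\<iota>\<^bsub>D\<^esub> (Fo X) \<otimes>\<^sub>m\<^bsub>D\<^esub> F0) = \<iota>\<^bsub>D\<^esub> (Fo X)"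

definition monoidal_natural_iso ::
  "('o, 'm, 'y) mon_cat_scheme \<Rightarrow> ('p, 'q, 'z) mon_cat_scheme \<Rightarrow>
   ('o \<Rightarrow> 'p) \<Rightarrow> ('m \<Rightarrow> 'q) \<Rightarrow> ('o \<Rightarrow> 'o \<Rightarrow> 'q) \<Rightarrow> 'q \<Rightarrow>
   ('o \<Rightarrow> 'p) \<Rightarrow> ('m \<Rightarrow> 'q) \<Rightarrow> ('o \<Rightarrow> 'o \<Rightarrow> 'q) \<Rightarrow> 'q \<Rightarrow> ('o \<Rightarrow> 'q) \<Rightarrow> bool" where
  "monoidal_natural_iso C D Fo Fm F2 F0 Go Gm G2 G0 \<eta> \<longleftrightarrow>
     natural_iso C D Fo Fm Go Gm \<eta> \<and>
     (\<forall>X \<in> Ob C. \<forall>Y \<in> Ob C.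
        \<eta> (X \<otimes>\<^sub>o\<^bsub>C\<^esub> Y) \<cdot>\<^bsub>D\<^esub> F2 X Y = G2 X Y \<cdot>\<^bsub>D\<^esub> (\<eta> X \<otimes>\<^sub>m\<^bsub>D\<^esub> \<eta> Y)) \<and>
     \<eta> \<^bold>1\<^bsub>C\<^esub> \<cdot>\<^bsub>D\<^esub> F0 = G0"

definition monoidally_equivalent ::
  "('o, 'm, 'y) mon_cat_scheme \<Rightarrow> ('p, 'q, 'z) mon_cat_scheme \<Rightarrow> bool" where
  "monoidally_equivalent C D \<longleftrightarrow>
     (\<exists>Fo Fm F2 F0. monoidal_functor C D Fo Fm F2 F0 \<and> is_equivalence C D Fo Fm)"


section \<open>Pivotal structures\<close>

record ('o, 'm) piv_cat = "('o, 'm) mon_cat" +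
  dual :: "'o \<Rightarrow> 'o"
  ev :: "'o \<Rightarrow> 'm"
  coev :: "'o \<Rightarrow> 'm"
  piv :: "'o \<Rightarrow> 'm"

context
  fixes C :: "('o, 'm, 'z) piv_cat_scheme" (structure)
begin

text \<open>For \<open>f : X \<rightarrow> Y\<close> this is the transpose \<open>Y* = Y* \<otimes> 1 \<rightarrow> Y* \<otimes> (Y \<otimes> X*) \<rightarrow> (Y* \<otimes> Y) \<otimes> X* \<rightarrow> X*\<close>.\<close>

definition dual_mor :: "'m \<Rightarrow> 'm" where
  "dual_mor f = (let X = Dom C f; Y = Cod C f in
     (ev C Y \<otimes>\<^sub>m \<iota> (dual C X)) \<cdot> minv C (\<a> (dual C Y) Y (dual C X)) \<cdot>
     (\<iota> (dual C Y) \<otimes>\<^sub>m ((f \<otimes>\<^sub>m \<iota> (dual C X)) \<cdot> coev C X)))"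

text \<open>
  The evaluation \<open>(W* \<otimes> V*) \<otimes> (V \<otimes> W) \<rightarrow> 1\<close> and the canonical isomorphism
  \<open>W* \<otimes> V* \<rightarrow> (V \<otimes> W)*\<close> that it induces.
\<close>

definition ev_tens :: "'o \<Rightarrow> 'o \<Rightarrow> 'm" where
  "ev_tens V W =
     ev C W \<cdot> (\<iota> (dual C W) \<otimes>\<^sub>m ((ev C V \<otimes>\<^sub>m \<iota> W) \<cdot> minv C (\<a> (dual C V) V W))) \<cdot>
     \<a> (dual C W) (dual C V) (V \<otimes>\<^sub>o W)"

definition dual_tens :: "'o \<Rightarrow> 'o \<Rightarrow> 'm" where
  "dual_tens V W =
     (ev_tens V W \<otimes>\<^sub>m \<iota> (dual C (V \<otimes>\<^sub>o W))) \<cdot>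
     minv C (\<a> (dual C W \<otimes>\<^sub>o dual C V) (V \<otimes>\<^sub>o W) (dual C (V \<otimes>\<^sub>o W))) \<cdot>
     (\<iota> (dual C W \<otimes>\<^sub>o dual C V) \<otimes>\<^sub>m coev C (V \<otimes>\<^sub>o W))"

text \<open>
  The monoidal structure of the double dual functor:
  \<open>V** \<otimes> W** \<rightarrow> (W* \<otimes> V*)* \<rightarrow> (V \<otimes> W)**\<close>, the second map being the transpose of the inverse of
  \<^term>\<open>dual_tens V W\<close>; and \<open>1 \<rightarrow> 1* \<rightarrow> 1**\<close>, built likewise from the isomorphism
  \<open>coev C \<^bold>1 : 1 \<rightarrow> 1 \<otimes> 1* = 1*\<close>, whose inverse is \<open>ev C \<^bold>1 : 1* = 1* \<otimes> 1 \<rightarrow> 1\<close>.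
\<close>

definition ddual_tens :: "'o \<Rightarrow> 'o \<Rightarrow> 'm" where
  "ddual_tens V W = dual_mor (minv C (dual_tens V W)) \<cdot> dual_tens (dual C W) (dual C V)"

definition ddual_unit :: "'m" where
  "ddual_unit = dual_mor (ev C \<^bold>1) \<cdot> coev C \<^bold>1"

end

locale pivotal_fusion_category = fusion_category C
  for C :: "('o, 'm, 'z) piv_cat_scheme" (structure) +
  assumes chosen_left_dual: "X \<in> Ob C \<Longrightarrow> is_left_dual C X (dual C X) (ev C X) (coev C X)"
    and pivotal: "monoidal_natural_iso C C
      id id (\<lambda>X Y. \<iota> (X \<otimes>\<^sub>o Y)) (\<iota> \<^bold>1)
      (dual C \<circ> dual C) (dual_mor C \<circ> dual_mor C) (ddual_tens C) (ddual_unit C) (piv C)"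


section \<open>Trace of an endomorphism\<close>

text \<open>
  The trace of a linear endomorphism \<open>T\<close> of a finite-dimensional complex vector space \<open>V\<close>, as the
  sum of the diagonal matrix entries in a basis; it does not depend on the basis chosen.
\<close>

definition coord :: "(complex, 'a) module \<Rightarrow> 'a set \<Rightarrow> 'a \<Rightarrow> 'a \<Rightarrow> complex" where
  "coord V B v b = (THE c. \<exists>a. module.lincomb V a B = v \<and> a b = c)"

definition lin_trace :: "(complex, 'a) module \<Rightarrow> ('a \<Rightarrow> 'a) \<Rightarrow> complex" where
  "lin_trace V T = (let B = (SOME B. finite B \<and> vectorspace.basis (class_ring :: complex ring) V B)
     in \<Sum>b\<in>B. coord V B (T b) b)"


section \<open>Pivotal dimensions and Frobenius-Schur indicators\<close>

context
  fixes C :: "('o, 'm, 'z) piv_cat_scheme" (structure)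
begin

definition scalar_of :: "'m \<Rightarrow> complex" where
  "scalar_of f = (THE c. f = mscale C c (\<iota> \<^bold>1))"

definition pdim :: "'o \<Rightarrow> complex" where
  "pdim V = scalar_of (ev C (dual C V) \<cdot> (piv C V \<otimes>\<^sub>m \<iota> (dual C V)) \<cdot> coev C V)"

fun tpow :: "'o \<Rightarrow> nat \<Rightarrow> 'o" where
  "tpow V 0 = \<^bold>1"
| "tpow V (Suc 0) = V"
| "tpow V (Suc (Suc n)) = V \<otimes>\<^sub>o tpow V (Suc n)"

text \<open>
  The canonical isomorphism \<^term>\<open>tpow_assoc V n\<close> from \<^term>\<open>tpow V (n - 1) \<otimes>\<^sub>o V\<close> to
  \<^term>\<open>tpow V n\<close> for \<open>n \<ge> 1\<close>; the value at \<open>0\<close> is irrelevant.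
\<close>

fun tpow_assoc :: "'o \<Rightarrow> nat \<Rightarrow> 'm" where
  "tpow_assoc V 0 = \<iota> \<^bold>1"
| "tpow_assoc V (Suc 0) = \<iota> V"
| "tpow_assoc V (Suc (Suc 0)) = \<iota> (V \<otimes>\<^sub>o V)"
| "tpow_assoc V (Suc (Suc (Suc n))) =
     (\<iota> V \<otimes>\<^sub>m tpow_assoc V (Suc (Suc n))) \<cdot> \<a> V (tpow V (Suc n)) V"

definition fs_D :: "'o \<Rightarrow> 'o \<Rightarrow> 'm \<Rightarrow> 'm" where
  "fs_D V W f =
     (let f' = (ev C V \<otimes>\<^sub>m \<iota> W) \<cdot> minv C (\<a> (dual C V) V W) \<cdot> (\<iota> (dual C V) \<otimes>\<^sub>m f)
      in (f' \<otimes>\<^sub>m \<iota> (dual C (dual C V))) \<cdot> coev C (dual C V))"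

definition fs_E :: "nat \<Rightarrow> 'o \<Rightarrow> 'm \<Rightarrow> 'm" where
  "fs_E n V f =
     tpow_assoc V n \<cdot> (\<iota> (tpow V (n - 1)) \<otimes>\<^sub>m minv C (piv C V)) \<cdot> fs_D V (tpow V (n - 1)) f"

definition fs_indicator :: "nat \<Rightarrow> 'o \<Rightarrow> complex" where
  "fs_indicator n V = lin_trace (hom_space C \<^bold>1 (tpow V n)) (fs_E n V)"

text \<open>The indicator of the category, computed with the set \<open>I\<close> of representatives of the simple objects.\<close>

definition fs_indicator_cat :: "'o set \<Rightarrow> nat \<Rightarrow> complex" where
  "fs_indicator_cat I n = (\<Sum>V\<in>I. fs_indicator n V * pdim V)"

end

end

theory Submission
  imports Defs
begin

text \<open>
  For simple \<open>V\<close> the product \<open>\<nu>\<^sub>n(V) pdim(V)\<close> does not depend on the pivotal structure: \<open>j\<^sub>V : V \<rightarrow> V**\<close> is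
  unique up to a scalar \<open>c\<close>, and replacing it by \<open>c j\<^sub>V\<close> multiplies \<open>pdim(V)\<close> by \<open>c\<close> and the operator
  \<open>E\<^sub>V\<close>, which contains the inverse of \<open>j\<^sub>V\<close>, by \<open>1 / c\<close>.  A monoidal equivalence \<open>F\<close> transports the
  duality data of \<open>V\<close> to those of a simple object \<open>W \<cong> F V\<close>, because duals are unique; it hence
  identifies the two products, and it induces a bijection of the simple objects.
\<close>

section \<open>Traces and linear bijections\<close>

text \<open>The obstacle is coherence. \<open>F\<close> commutes with the unit, tensor products and
  duals only up to isomorphism, and the operator on Hom(1, V^n) mixes all of them with iterated
  associators; comparing it with its image directly would mean a large diagram chase. Instead, every
  ingredient is paired with its counterpart in \<open>D\<close>: a morphism x : A \<rightarrow> F X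
  is treated as an object of a comma category, and a commutative square as a morphism. Associators,
  evaluations and coevaluations form such squares, and squares are closed under composition and
  tensor product, so an expression built from them is transported by building the same expression
  from squares. If the target of a square is an isomorphism, its component in \<open>C\<close>
  determines its component in \<open>D\<close>; in this way identities in \<open>C\<close> become
  identities in \<open>D\<close>. The price is that duals have to be matched together with their
  evaluations and coevaluations, exactly and not up to scalars. The trace lemma carries a scalar
  factor from the start, because the two operators are conjugate only up to
  \<open>1 / c\<close>.\<close>

context
  fixes V :: "(complex, 'a) module" and B :: "'a set"
  assumes vs: "vectorspace class_ring V" and fin: "finite B"
    and basis: "vectorspace.basis class_ring V B"
begin

interpretation V: vectorspace "class_ring :: complex ring" V
  by (fact vs)

lemma basis_sub: "B \<subseteq> carrier V"
  using basis by (simp add: V.basis_def)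

text \<open>Uniqueness holds among functions that are extensional on \<open>B\<close>, since values
  outside \<open>B\<close> do not matter; hence the use of \<open>restrict\<close> below.\<close>

lemma unique_coords:
  assumes "v \<in> carrier V"
  shows "\<exists>!a. a \<in> B \<rightarrow>\<^sub>E UNIV \<and> module.lincomb V a B = v"
  using V.basis_criterion[OF fin basis_sub] basis assms by auto

lemma lincomb_restrict: "module.lincomb V (restrict a B) B = module.lincomb V a B"
  by (rule V.lincomb_cong) (auto simp: basis_sub)

lemma lincomb_in: "module.lincomb V a B \<in> carrier V"
  by (rule V.lincomb_closed) (auto simp: basis_sub)

text \<open>This makes the definite description in \<open>coord\<close> usable: whichever
  coefficients represent a vector, they are its coordinates on \<open>B\<close>.\<close>

lemma coord_lincomb:
  assumes "b \<in> B"
  shows "coord V B (module.lincomb V a B) b = a b"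
  unfolding coord_def
proof (rule the_equality)
  fix c assume "\<exists>a'. module.lincomb V a' B = module.lincomb V a B \<and> a' b = c"
  then obtain a' where a': "module.lincomb V a' B = module.lincomb V a B" "a' b = c" by blast
  have "restrict a' B = restrict a B"
    using unique_coords[OF lincomb_in[of a]] a'(1)
    by (metis lincomb_restrict restrict_PiE UNIV_I restrict_PiE_iff)
  then show "c = a b" using a'(2) assms by (metis restrict_apply')
qed blast

lemma lincomb_coord:
  assumes "v \<in> carrier V"
  shows "module.lincomb V (coord V B v) B = v"
proof -
  obtain a where a: "module.lincomb V a B = v" using unique_coords[OF assms] by blast
  have "module.lincomb V (coord V B v) B = module.lincomb V a B"
    by (rule V.lincomb_cong) (auto simp: basis_sub coord_lincomb a[symmetric])
  then show ?thesis using a by simp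
qed

text \<open>Complex-valued functionals suffice, because the maps to be expanded later are single
  coordinates of images.\<close>

lemma functional_lincomb:
  fixes \<phi> :: "'a \<Rightarrow> complex"
  assumes add: "\<And>u v. u \<in> carrier V \<Longrightarrow> v \<in> carrier V \<Longrightarrow> \<phi> (u \<oplus>\<^bsub>V\<^esub> v) = \<phi> u + \<phi> v"
    and smult: "\<And>c v. v \<in> carrier V \<Longrightarrow> \<phi> (c \<odot>\<^bsub>V\<^esub> v) = c * \<phi> v"
  shows "\<phi> (module.lincomb V a B) = (\<Sum>b\<in>B. a b * \<phi> b)"
proof -
  have zero: "\<phi> \<zero>\<^bsub>V\<^esub> = 0"
    using smult[of "\<zero>\<^bsub>V\<^esub>" 0] V.smult_l_null[of "\<zero>\<^bsub>V\<^esub>"] by simp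
  have "\<phi> (module.lincomb V a A) = (\<Sum>b\<in>A. a b * \<phi> b)" if "finite A" "A \<subseteq> B" for A
    using that
  proof (induction A)
    case empty
    then show ?case by (simp add: V.lincomb_def zero)
  next
    case (insert x A)
    have "A \<subseteq> carrier V" "x \<in> carrier V" using insert.prems basis_sub by auto
    then have "\<phi> (module.lincomb V a (A \<union> {x})) = \<phi> (a x \<odot>\<^bsub>V\<^esub> x) + \<phi> (module.lincomb V a A)"
      using insert.hyps by (subst V.lincomb_insert) (auto intro!: add V.lincomb_closed)
    then show ?case using insert \<open>x \<in> carrier V\<close> by (simp add: smult)
  qed
  then show ?thesis using fin by blast
qed

lemma functional_expand:
  fixes \<phi> :: "'a \<Rightarrow> complex"
  assumes "\<And>u v. u \<in> carrier V \<Longrightarrow> v \<in> carrier V \<Longrightarrow> \<phi> (u \<oplus>\<^bsub>V\<^esub> v) = \<phi> u + \<phi> v"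
    and "\<And>c v. v \<in> carrier V \<Longrightarrow> \<phi> (c \<odot>\<^bsub>V\<^esub> v) = c * \<phi> v"
    and "v \<in> carrier V"
  shows "\<phi> v = (\<Sum>b\<in>B. coord V B v b * \<phi> b)"
  using functional_lincomb[OF assms(1,2), where a = "coord V B v"] lincomb_coord[OF assms(3)] by simp

lemma coord_add:
  assumes "u \<in> carrier V" "v \<in> carrier V" "b \<in> B"
  shows "coord V B (u \<oplus>\<^bsub>V\<^esub> v) b = coord V B u b + coord V B v b"
proof -
  have "module.lincomb V (\<lambda>b. coord V B u b + coord V B v b) B = u \<oplus>\<^bsub>V\<^esub> v"
  proof -
    have "module.lincomb V (\<lambda>b. coord V B u b + coord V B v b) B
      = (\<Oplus>\<^bsub>V\<^esub>b\<in>B. coord V B u b \<odot>\<^bsub>V\<^esub> b \<oplus>\<^bsub>V\<^esub> coord V B v b \<odot>\<^bsub>V\<^esub> b)"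
      unfolding V.lincomb_def
      by (rule V.finsum_cong') (use basis_sub V.smult_l_distr in \<open>auto simp: subset_iff\<close>)
    also have "\<dots> = module.lincomb V (coord V B u) B \<oplus>\<^bsub>V\<^esub> module.lincomb V (coord V B v) B"
      unfolding V.lincomb_def
      by (rule V.finsum_addf) (use basis_sub in \<open>auto simp: subset_iff\<close>)
    finally have "module.lincomb V (\<lambda>b. coord V B u b + coord V B v b) B
      = module.lincomb V (coord V B u) B \<oplus>\<^bsub>V\<^esub> module.lincomb V (coord V B v) B" .
    then show ?thesis using lincomb_coord assms by simp
  qed
  then show ?thesis using coord_lincomb[OF assms(3), of "\<lambda>b. coord V B u b + coord V B v b"] by simp
qed

lemma coord_smult:
  assumes "v \<in> carrier V" "b \<in> B"
  shows "coord V B (c \<odot>\<^bsub>V\<^esub> v) b = c * coord V B v b"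
proof -
  have "module.lincomb V (\<lambda>b. c * coord V B v b) B = c \<odot>\<^bsub>V\<^esub> v"
    using V.lincomb_smult[OF basis_sub, of "coord V B v" c] lincomb_coord[OF assms(1)] by simp
  then show ?thesis using coord_lincomb[OF assms(2), of "\<lambda>b. c * coord V B v b"] by simp
qed

end

lemma chosen_basis:
  assumes "vectorspace (class_ring :: complex ring) V"
    and "vectorspace.fin_dim (class_ring :: complex ring) V"
  defines "B \<equiv> SOME B. finite B \<and> vectorspace.basis (class_ring :: complex ring) V B"
  shows "finite B \<and> vectorspace.basis (class_ring :: complex ring) V B"
  unfolding B_def by (rule someI_ex) (rule vectorspace.finite_basis_exists[OF assms(1,2)])

text \<open>The bases of \<open>V\<close> and \<open>W\<close> are unrelated choices, so
  \<open>P\<close> cannot be assumed to send one to the other. Both traces are compared with a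
  double sum over products of matrix entries of \<open>P T\<close> and of \<open>Q\<close>. This is
  the cyclicity tr(P T Q) = tr(Q P T), and it includes independence of the basis.\<close>

lemma lin_trace_conjugate_inverse:
  fixes V :: "(complex, 'a) module" and W :: "(complex, 'b) module"
  assumes V: "vectorspace class_ring V" "vectorspace.fin_dim class_ring V"
    and W: "vectorspace class_ring W" "vectorspace.fin_dim class_ring W"
    and P: "P \<in> linear_maps V W" and Q: "Q \<in> linear_maps W V"
    and QP: "\<And>v. v \<in> carrier V \<Longrightarrow> Q (P v) = v" and PQ: "\<And>w. w \<in> carrier W \<Longrightarrow> P (Q w) = w"
    and T: "T \<in> linear_maps V V"
    and conj: "\<And>v. v \<in> carrier V \<Longrightarrow> S (P v) = c \<odot>\<^bsub>W\<^esub> P (T v)"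
  shows "lin_trace W S = c * lin_trace V T"
proof -
  define B where "B = (SOME B. finite B \<and> vectorspace.basis (class_ring :: complex ring) V B)"
  define B' where "B' = (SOME B. finite B \<and> vectorspace.basis (class_ring :: complex ring) W B)"
  have B: "finite B" "vectorspace.basis class_ring V B"
    and B': "finite B'" "vectorspace.basis class_ring W B'"
    using chosen_basis[OF V] chosen_basis[OF W] by (auto simp: B_def B'_def)
  note cV = V(1) B and cW = W(1) B'
  have sub: "B \<subseteq> carrier V" "B' \<subseteq> carrier W"
    using basis_sub[OF cV] basis_sub[OF cW] by auto
  have cl: "P v \<in> carrier W" "T v \<in> carrier V" if "v \<in> carrier V" for v
    using LinearCombinations.module_hom_closed[OF P] LinearCombinations.module_hom_closed[OF T] that by auto
  have clQ: "Q w \<in> carrier V" if "w \<in> carrier W" for w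
    using LinearCombinations.module_hom_closed[OF Q] that by auto
  have PT: "coord W B' (P (T v)) b' = (\<Sum>b\<in>B. coord V B v b * coord W B' (P (T b)) b')"
    if "v \<in> carrier V" "b' \<in> B'" for v b'
    by (rule functional_expand[OF cV])
      (use that in \<open>simp_all add: LinearCombinations.module_hom_add[OF P] LinearCombinations.module_hom_add[OF T] LinearCombinations.module_hom_smult[OF P]
        LinearCombinations.module_hom_smult[OF T] coord_add[OF cW] coord_smult[OF cW] cl\<close>)
  have inv: "coord V B (Q w) b = (\<Sum>b'\<in>B'. coord W B' w b' * coord V B (Q b') b)"
    if "w \<in> carrier W" "b \<in> B" for w b
    by (rule functional_expand[OF cW])
      (use that in \<open>simp_all add: LinearCombinations.module_hom_add[OF Q] LinearCombinations.module_hom_smult[OF Q]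
        coord_add[OF cV] coord_smult[OF cV] clQ\<close>)
  \<comment> \<open>Writing \<open>b'\<close> as \<open>P (Q b')\<close> makes \<open>conj\<close>
    applicable, which speaks only about values of \<open>P\<close>.\<close>
  have "lin_trace W S = (\<Sum>b'\<in>B'. coord W B' (S (P (Q b'))) b')"
    unfolding lin_trace_def Let_def B'_def[symmetric] using PQ sub by (auto intro!: sum.cong)
  also have "\<dots> = (\<Sum>b'\<in>B'. c * (\<Sum>b\<in>B. coord V B (Q b') b * coord W B' (P (T b)) b'))"
    by (intro sum.cong refl)
      (use sub in \<open>auto simp: conj clQ coord_smult[OF cW] cl PT[symmetric] subset_iff\<close>)
  also have "\<dots> = c * (\<Sum>b\<in>B. \<Sum>b'\<in>B'. coord W B' (P (T b)) b' * coord V B (Q b') b)"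
    by (subst sum.swap) (simp add: sum_distrib_left mult.commute)
  also have "\<dots> = c * (\<Sum>b\<in>B. coord V B (T b) b)"
    by (intro arg_cong[where f = "(*) c"] sum.cong refl)
      (use sub in \<open>auto simp: inv[symmetric] cl QP subset_iff\<close>)
  also have "\<dots> = c * lin_trace V T"
    by (simp add: lin_trace_def Let_def B_def)
  finally show ?thesis .
qed

text \<open>The inverse of a linear bijection is linear: \<open>P\<close> sends the expected value
  of \<open>?Q\<close> to the right vector, and \<open>?Q\<close> undoes \<open>P\<close>.\<close>

lemma lin_trace_conjugate:
  fixes V :: "(complex, 'a) module" and W :: "(complex, 'b) module"
  assumes V: "vectorspace class_ring V" "vectorspace.fin_dim class_ring V"
    and W: "vectorspace class_ring W" "vectorspace.fin_dim class_ring W"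
    and P: "P \<in> linear_maps V W" and bij: "bij_betw P (carrier V) (carrier W)"
    and T: "T \<in> linear_maps V V"
    and conj: "\<And>v. v \<in> carrier V \<Longrightarrow> S (P v) = c \<odot>\<^bsub>W\<^esub> P (T v)"
  shows "lin_trace W S = c * lin_trace V T"
proof (rule lin_trace_conjugate_inverse[OF V W P _ _ _ T conj])
  interpret V: vectorspace "class_ring :: complex ring" V by (fact V(1))
  interpret W: vectorspace "class_ring :: complex ring" W by (fact W(1))
  let ?Q = "the_inv_into (carrier V) P"
  have inj: "inj_on P (carrier V)" and im: "P ` carrier V = carrier W"
    using bij by (auto simp: bij_betw_def)
  show QP: "?Q (P v) = v" if "v \<in> carrier V" for v
    using that by (rule the_inv_into_f_f[OF inj])
  show PQ: "P (?Q w) = w" if "w \<in> carrier W" for w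
    using that f_the_inv_into_f[OF inj] im by simp
  have Q: "?Q w \<in> carrier V" if "w \<in> carrier W" for w
    using that the_inv_into_into[OF inj _ subset_refl] im by simp
  have "?Q (u \<oplus>\<^bsub>W\<^esub> v) = ?Q u \<oplus>\<^bsub>V\<^esub> ?Q v" if "u \<in> carrier W" "v \<in> carrier W" for u v
    using QP[of "?Q u \<oplus>\<^bsub>V\<^esub> ?Q v"] that Q PQ by (simp add: LinearCombinations.module_hom_add[OF P])
  moreover have "?Q (r \<odot>\<^bsub>W\<^esub> u) = r \<odot>\<^bsub>V\<^esub> ?Q u" if "u \<in> carrier W" for r u
    using QP[of "r \<odot>\<^bsub>V\<^esub> ?Q u"] that Q PQ by (simp add: LinearCombinations.module_hom_smult[OF P])
  ultimately show "?Q \<in> linear_maps W V"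
    using Q by (simp add: LinearCombinations.module_hom_def)
qed

section \<open>Linear and monoidal categories\<close>

lemma Hom_iff: "f \<in> Hom C X Y \<longleftrightarrow> f \<in> Mor C \<and> Dom C f = X \<and> Cod C f = Y"
  by (simp add: Hom_def)

lemma hom_space_simps [simp]:
  "carrier (hom_space C X Y) = Hom C X Y" "\<zero>\<^bsub>hom_space C X Y\<^esub> = mzero C X Y"
  "f \<oplus>\<^bsub>hom_space C X Y\<^esub> g = madd C f g" "c \<odot>\<^bsub>hom_space C X Y\<^esub> f = mscale C c f"
  by (simp_all add: hom_space_def)

lemma linear_maps_iff:
  "T \<in> linear_maps (hom_space C X Y) (hom_space D X' Y') \<longleftrightarrow>
    (\<forall>f \<in> Hom C X Y. T f \<in> Hom D X' Y') \<and>
    (\<forall>f \<in> Hom C X Y. \<forall>g \<in> Hom C X Y. T (madd C f g) = madd D (T f) (T g)) \<and>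
    (\<forall>c. \<forall>f \<in> Hom C X Y. T (mscale C c f) = mscale D c (T f))"
  by (auto simp: LinearCombinations.module_hom_def Pi_iff)

lemma linear_maps_comp:
  assumes "S \<in> linear_maps U V" "T \<in> linear_maps V W"
  shows "(\<lambda>x. T (S x)) \<in> linear_maps U W"
  using assms by (auto simp: LinearCombinations.module_hom_def Pi_iff)

context lin_category
begin

lemma mor_obs [simp]: "f \<in> Mor C \<Longrightarrow> Dom C f \<in> Ob C" "f \<in> Mor C \<Longrightarrow> Cod C f \<in> Ob C"
  by (fact Dom_in_Ob, fact Cod_in_Ob)

lemma idt_simps [simp]:
  assumes "X \<in> Ob C"
  shows "\<iota> X \<in> Mor C" "Dom C (\<iota> X) = X" "Cod C (\<iota> X) = X"
  using idt_in_Hom[OF assms] by (simp_all add: Hom_iff)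

text \<open>Typing is expressed by equations on \<open>Dom\<close> and \<open>Cod\<close>, so that
  it is settled by rewriting and no intermediate objects have to be guessed.\<close>

lemma cmp_simps [simp]:
  assumes "f \<in> Mor C" "g \<in> Mor C" "Cod C f = Dom C g"
  shows "g \<cdot> f \<in> Mor C" "Dom C (g \<cdot> f) = Dom C f" "Cod C (g \<cdot> f) = Cod C g"
  using cmp_in_Hom[of f "Dom C f" "Cod C f" g "Cod C g"] assms by (simp_all add: Hom_iff)

lemma cmp_idt_simps [simp]:
  "f \<in> Mor C \<Longrightarrow> Dom C f = X \<Longrightarrow> f \<cdot> \<iota> X = f"
  "f \<in> Mor C \<Longrightarrow> Cod C f = X \<Longrightarrow> \<iota> X \<cdot> f = f"
  using cmp_idt_left cmp_idt_right by (auto simp: Hom_iff)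

lemma assoc_cmp:
  assumes "f \<in> Mor C" "g \<in> Mor C" "h \<in> Mor C" "Cod C f = Dom C g" "Cod C g = Dom C h"
  shows "(h \<cdot> g) \<cdot> f = h \<cdot> (g \<cdot> f)"
  using cmp_assoc[of f "Dom C f" "Dom C g" g "Dom C h" h] assms by (simp add: Hom_iff)

lemma mutually_inverse_unique:
  assumes "mutually_inverse C f g" "mutually_inverse C f h"
  shows "g = h"
proof -
  have "g = g \<cdot> (f \<cdot> h)" using assms by (auto simp: mutually_inverse_def Hom_iff)
  also have "\<dots> = (g \<cdot> f) \<cdot> h" using assms by (subst assoc_cmp) (auto simp: mutually_inverse_def Hom_iff)
  also have "\<dots> = h" using assms by (auto simp: mutually_inverse_def Hom_iff)
  finally show ?thesis .
qed

lemma minv_eqI: "mutually_inverse C f g \<Longrightarrow> minv C f = g"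
  unfolding minv_def using mutually_inverse_unique by blast

lemma mutually_inverse_minv: "iso_mor C f \<Longrightarrow> mutually_inverse C f (minv C f)"
  using minv_eqI by (auto simp: iso_mor_def)

lemma minv_simps [simp]:
  assumes "iso_mor C f"
  shows "minv C f \<in> Mor C" "Dom C (minv C f) = Cod C f" "Cod C (minv C f) = Dom C f"
    "minv C f \<cdot> f = \<iota> (Dom C f)" "f \<cdot> minv C f = \<iota> (Cod C f)"
  using mutually_inverse_minv[OF assms] by (auto simp: mutually_inverse_def Hom_iff)

lemma iso_mor_Mor [simp]: "iso_mor C f \<Longrightarrow> f \<in> Mor C"
  by (auto simp: iso_mor_def mutually_inverse_def)

lemma minv_cancel [simp]:
  assumes "iso_mor C f" "g \<in> Mor C"
  shows "Cod C g = Dom C f \<Longrightarrow> minv C f \<cdot> (f \<cdot> g) = g" "Cod C g = Cod C f \<Longrightarrow> f \<cdot> (minv C f \<cdot> g) = g"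
  using assms by (simp_all add: assoc_cmp[symmetric])

lemma mutually_inverse_sym: "mutually_inverse C f g \<Longrightarrow> mutually_inverse C g f"
  by (auto simp: mutually_inverse_def Hom_iff)

lemma iso_minv [simp]:
  assumes "iso_mor C f"
  shows "iso_mor C (minv C f)" "minv C (minv C f) = f"
  using mutually_inverse_sym[OF mutually_inverse_minv[OF assms]] minv_eqI
  by (auto simp: iso_mor_def)

lemma iso_idt [simp]:
  assumes "X \<in> Ob C" shows "iso_mor C (\<iota> X)" "minv C (\<iota> X) = \<iota> X"
proof -
  have "mutually_inverse C (\<iota> X) (\<iota> X)" using assms by (simp add: mutually_inverse_def Hom_iff)
  then show "iso_mor C (\<iota> X)" "minv C (\<iota> X) = \<iota> X" using minv_eqI by (auto simp: iso_mor_def)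
qed

lemma iso_cmp [simp]:
  assumes "iso_mor C f" "iso_mor C g" "Cod C f = Dom C g"
  shows "iso_mor C (g \<cdot> f)" "minv C (g \<cdot> f) = minv C f \<cdot> minv C g"
proof -
  have "mutually_inverse C (g \<cdot> f) (minv C f \<cdot> minv C g)"
    using assms by (simp add: mutually_inverse_def Hom_iff assoc_cmp)
  then show "iso_mor C (g \<cdot> f)" "minv C (g \<cdot> f) = minv C f \<cdot> minv C g"
    using minv_eqI by (auto simp: iso_mor_def)
qed

lemma iso_left_cancel:
  assumes "iso_mor C f" "f \<cdot> g = f \<cdot> h" "g \<in> Mor C" "h \<in> Mor C" "Cod C g = Dom C f" "Cod C h = Dom C f"
  shows "g = h"
  by (metis assms minv_cancel(1))

lemma isomorphic_sym: "isomorphic C X Y \<Longrightarrow> isomorphic C Y X"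
  unfolding isomorphic_def by (metis Hom_iff iso_minv(1) minv_simps(1,2,3))

lemma isomorphic_trans: "isomorphic C X Y \<Longrightarrow> isomorphic C Y Z \<Longrightarrow> isomorphic C X Z"
  unfolding isomorphic_def by (metis Hom_iff iso_cmp(1) iso_mor_Mor cmp_simps)

lemma zero_Hom: 
  assumes "X \<in> Ob C" "Y \<in> Ob C" shows "mzero C X Y \<in> Hom C X Y"
proof -
  interpret vectorspace "class_ring :: complex ring" "hom_space C X Y"
    by (rule hom_vectorspace[OF assms])
  show ?thesis using M.zero_closed by simp
qed

lemma zero_simps [simp]:
  assumes "X \<in> Ob C" "Y \<in> Ob C"
  shows "mzero C X Y \<in> Mor C" "Dom C (mzero C X Y) = X" "Cod C (mzero C X Y) = Y"
  using zero_Hom[OF assms] by (simp_all add: Hom_iff)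

lemma scale_Hom [simp]:
  assumes "f \<in> Mor C"
  shows "mscale C c f \<in> Mor C" "Dom C (mscale C c f) = Dom C f" "Cod C (mscale C c f) = Cod C f"
proof -
  interpret vectorspace "class_ring :: complex ring" "hom_space C (Dom C f) (Cod C f)"
    by (rule hom_vectorspace) (simp_all add: assms)
  show "mscale C c f \<in> Mor C" "Dom C (mscale C c f) = Dom C f" "Cod C (mscale C c f) = Cod C f"
    using smult_closed[of c f] assms by (simp_all add: Hom_iff)
qed

lemma scale_simps [simp]:
  assumes "f \<in> Mor C"
  shows "mscale C 1 f = f" "mscale C c (mscale C d f) = mscale C (c * d) f"
    "mscale C 0 f = mzero C (Dom C f) (Cod C f)"
proof -
  interpret vectorspace "class_ring :: complex ring" "hom_space C (Dom C f) (Cod C f)"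
    by (rule hom_vectorspace) (simp_all add: assms)
  show "mscale C 1 f = f" "mscale C c (mscale C d f) = mscale C (c * d) f"
    "mscale C 0 f = mzero C (Dom C f) (Cod C f)"
    using smult_one[of f] smult_assoc1[of c d f] smult_l_null[of f] assms by (simp_all add: Hom_iff)
qed

lemma cmp_scale [simp]:
  assumes "f \<in> Mor C" "g \<in> Mor C" "Cod C f = Dom C g"
  shows "mscale C c g \<cdot> f = mscale C c (g \<cdot> f)" "g \<cdot> mscale C c f = mscale C c (g \<cdot> f)"
  using cmp_linear_left[of f "Dom C f" "Cod C f" "Cod C g"]
    cmp_linear_right[of "Dom C f" g "Dom C g" "Cod C g"] assms
  by (auto simp: linear_maps_iff Hom_iff)

text \<open>The zero morphism is \<open>0\<close> times itself, and composition is
  homogeneous.\<close>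

lemma cmp_zero:
  assumes "g \<in> Mor C" "X \<in> Ob C" "Dom C g = Y"
  shows "g \<cdot> mzero C X Y = mzero C X (Cod C g)"
proof -
  have "g \<cdot> mscale C 0 (mzero C X Y) = mscale C 0 (g \<cdot> mzero C X Y)"
    by (rule cmp_scale) (use assms in auto)
  then show ?thesis using assms by auto
qed

end

section \<open>Strictly unital monoidal categories\<close>

context lin_monoidal_category
begin

lemma unit_tens_ob [simp]: "\<^bold>1 \<in> Ob C" "X \<in> Ob C \<Longrightarrow> \<^bold>1 \<otimes>\<^sub>o X = X" "X \<in> Ob C \<Longrightarrow> X \<otimes>\<^sub>o \<^bold>1 = X"
    "X \<in> Ob C \<Longrightarrow> Y \<in> Ob C \<Longrightarrow> X \<otimes>\<^sub>o Y \<in> Ob C"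
  by (simp_all add: unit_in_Ob unit_ob_left unit_ob_right tens_in_Ob)

lemma tens_simps [simp]:
  assumes "f \<in> Mor C" "g \<in> Mor C"
  shows "f \<otimes>\<^sub>m g \<in> Mor C" "Dom C (f \<otimes>\<^sub>m g) = Dom C f \<otimes>\<^sub>o Dom C g"
    "Cod C (f \<otimes>\<^sub>m g) = Cod C f \<otimes>\<^sub>o Cod C g"
  using tens_linear_left[of "Dom C f" "Cod C f" g "Dom C g" "Cod C g"] assms
  by (simp_all add: linear_maps_iff Hom_iff)

lemma tens_scale [simp]:
  assumes "f \<in> Mor C" "g \<in> Mor C"
  shows "mscale C c f \<otimes>\<^sub>m g = mscale C c (f \<otimes>\<^sub>m g)" "f \<otimes>\<^sub>m mscale C c g = mscale C c (f \<otimes>\<^sub>m g)"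
  using tens_linear_left[of "Dom C f" "Cod C f" g "Dom C g" "Cod C g"]
    tens_linear_right[of f "Dom C f" "Cod C f" "Dom C g" "Cod C g"] assms
  by (auto simp: linear_maps_iff Hom_iff)

lemma tens_unit [simp]: "f \<in> Mor C \<Longrightarrow> \<iota> \<^bold>1 \<otimes>\<^sub>m f = f" "f \<in> Mor C \<Longrightarrow> f \<otimes>\<^sub>m \<iota> \<^bold>1 = f"
  by (fact unit_mor_left, fact unit_mor_right)

lemma cmp_tens:
  assumes "f \<in> Mor C" "g \<in> Mor C" "f' \<in> Mor C" "g' \<in> Mor C" "Cod C f = Dom C g" "Cod C f' = Dom C g'"
  shows "(g \<otimes>\<^sub>m g') \<cdot> (f \<otimes>\<^sub>m f') = (g \<cdot> f) \<otimes>\<^sub>m (g' \<cdot> f')"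
  using tens_cmp[of f "Dom C f" "Dom C g" g "Cod C g" f' "Dom C f'" "Dom C g'" g' "Cod C g'"] assms
  by (simp add: Hom_iff)

lemma iso_tens [simp]:
  assumes "iso_mor C f" "iso_mor C g"
  shows "iso_mor C (f \<otimes>\<^sub>m g)" "minv C (f \<otimes>\<^sub>m g) = minv C f \<otimes>\<^sub>m minv C g"
proof -
  have "mutually_inverse C (f \<otimes>\<^sub>m g) (minv C f \<otimes>\<^sub>m minv C g)"
    using assms by (simp add: mutually_inverse_def Hom_iff cmp_tens tens_idt)
  then show "iso_mor C (f \<otimes>\<^sub>m g)" "minv C (f \<otimes>\<^sub>m g) = minv C f \<otimes>\<^sub>m minv C g"
    using minv_eqI by (auto simp: iso_mor_def)
qed

lemma assoc_simps [simp]: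
  assumes "X \<in> Ob C" "Y \<in> Ob C" "Z \<in> Ob C"
  shows "iso_mor C (\<a> X Y Z)" "\<a> X Y Z \<in> Mor C" "Dom C (\<a> X Y Z) = (X \<otimes>\<^sub>o Y) \<otimes>\<^sub>o Z"
    "Cod C (\<a> X Y Z) = X \<otimes>\<^sub>o (Y \<otimes>\<^sub>o Z)"
  using assoc_in_Hom[OF assms] assoc_iso[OF assms] by (simp_all add: Hom_iff)

lemma assoc_nat:
  assumes "f \<in> Mor C" "g \<in> Mor C" "h \<in> Mor C"
  shows "\<a> (Cod C f) (Cod C g) (Cod C h) \<cdot> ((f \<otimes>\<^sub>m g) \<otimes>\<^sub>m h) = (f \<otimes>\<^sub>m (g \<otimes>\<^sub>m h)) \<cdot> \<a> (Dom C f) (Dom C g) (Dom C h)"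
  by (rule assoc_natural) (use assms in \<open>simp_all add: Hom_iff\<close>)

lemma assoc_inv_nat:
  assumes "f \<in> Mor C" "g \<in> Mor C" "h \<in> Mor C"
  shows "minv C (\<a> (Cod C f) (Cod C g) (Cod C h)) \<cdot> (f \<otimes>\<^sub>m (g \<otimes>\<^sub>m h))
    = ((f \<otimes>\<^sub>m g) \<otimes>\<^sub>m h) \<cdot> minv C (\<a> (Dom C f) (Dom C g) (Dom C h))"
proof (rule iso_left_cancel[where f = "\<a> (Cod C f) (Cod C g) (Cod C h)"])
  have "\<a> (Cod C f) (Cod C g) (Cod C h) \<cdot> (((f \<otimes>\<^sub>m g) \<otimes>\<^sub>m h) \<cdot> minv C (\<a> (Dom C f) (Dom C g) (Dom C h)))
    = (\<a> (Cod C f) (Cod C g) (Cod C h) \<cdot> ((f \<otimes>\<^sub>m g) \<otimes>\<^sub>m h)) \<cdot> minv C (\<a> (Dom C f) (Dom C g) (Dom C h))"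
    using assms by (subst assoc_cmp) simp_all
  also have "\<dots> = f \<otimes>\<^sub>m (g \<otimes>\<^sub>m h)"
    unfolding assoc_nat[OF assms] using assms by (simp add: assoc_cmp)
  finally show "\<a> (Cod C f) (Cod C g) (Cod C h) \<cdot> minv C (\<a> (Cod C f) (Cod C g) (Cod C h)) \<cdot> (f \<otimes>\<^sub>m (g \<otimes>\<^sub>m h))
    = \<a> (Cod C f) (Cod C g) (Cod C h) \<cdot> ((f \<otimes>\<^sub>m g) \<otimes>\<^sub>m h) \<cdot> minv C (\<a> (Dom C f) (Dom C g) (Dom C h))"
    using assms by simp
qed (use assms in simp_all)

lemma iso_idempotent: "iso_mor C f \<Longrightarrow> Dom C f = X \<Longrightarrow> Cod C f = X \<Longrightarrow> f \<cdot> f = f \<Longrightarrow> f = \<iota> X"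
  by (rule iso_left_cancel[where f = f]) auto

text \<open>The triangle axiom covers only a unit in the middle. For an outer unit, the pentagon
  with two adjacent units collapses to \<open>f = f \<cdot> f\<close>, where \<open>f\<close> is the
  associator in question, and an idempotent isomorphism is an identity.\<close>

lemma assoc_unit [simp]:
  assumes "X \<in> Ob C" "Y \<in> Ob C"
  shows "\<a> \<^bold>1 X Y = \<iota> (X \<otimes>\<^sub>o Y)" "\<a> X \<^bold>1 Y = \<iota> (X \<otimes>\<^sub>o Y)" "\<a> X Y \<^bold>1 = \<iota> (X \<otimes>\<^sub>o Y)"
proof -
  have 1: "\<a> \<^bold>1 \<^bold>1 X = \<iota> X" "\<a> X \<^bold>1 \<^bold>1 = \<iota> X" if "X \<in> Ob C" for X
    using triangle[of "\<^bold>1" X] triangle[of X "\<^bold>1"] that by simp_all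
  show "\<a> X \<^bold>1 Y = \<iota> (X \<otimes>\<^sub>o Y)" by (rule triangle[OF assms])
  show "\<a> \<^bold>1 X Y = \<iota> (X \<otimes>\<^sub>o Y)"
    by (rule iso_idempotent) (use pentagon[of "\<^bold>1" "\<^bold>1" X Y] assms 1 in \<open>simp_all add: tens_idt\<close>)
  show "\<a> X Y \<^bold>1 = \<iota> (X \<otimes>\<^sub>o Y)"
    by (rule iso_idempotent) (use pentagon[of X Y "\<^bold>1" "\<^bold>1"] assms 1 in \<open>simp_all add: tens_idt\<close>)
qed

section \<open>Left duals and their uniqueness\<close>

lemma pentagon_left:
  assumes "W \<in> Ob C" "X \<in> Ob C" "Y \<in> Ob C" "Z \<in> Ob C"
  shows "(\<iota> W \<otimes>\<^sub>m minv C (\<a> X Y Z)) \<cdot> \<a> W X (Y \<otimes>\<^sub>o Z)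
    = \<a> W (X \<otimes>\<^sub>o Y) Z \<cdot> (\<a> W X Y \<otimes>\<^sub>m \<iota> Z) \<cdot> minv C (\<a> (W \<otimes>\<^sub>o X) Y Z)"
proof -
  have "(\<iota> W \<otimes>\<^sub>m minv C (\<a> X Y Z)) \<cdot> \<a> W X (Y \<otimes>\<^sub>o Z)
    = minv C (\<iota> W \<otimes>\<^sub>m \<a> X Y Z) \<cdot> (\<a> W X (Y \<otimes>\<^sub>o Z) \<cdot> \<a> (W \<otimes>\<^sub>o X) Y Z) \<cdot> minv C (\<a> (W \<otimes>\<^sub>o X) Y Z)"
    using assms by (simp add: assoc_cmp)
  also have "\<dots> = \<a> W (X \<otimes>\<^sub>o Y) Z \<cdot> (\<a> W X Y \<otimes>\<^sub>m \<iota> Z) \<cdot> minv C (\<a> (W \<otimes>\<^sub>o X) Y Z)"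
    unfolding pentagon[OF assms] using assms by (simp add: assoc_cmp del: iso_tens(2))
  finally show ?thesis .
qed

text \<open>Both variants solve the pentagon for the place where an inverse associator separates the
  two halves of a zigzag; the former is used for coevaluations, this one for evaluations.\<close>

lemma pentagon_right:
  assumes "W \<in> Ob C" "X \<in> Ob C" "Y \<in> Ob C" "Z \<in> Ob C"
  shows "\<a> (W \<otimes>\<^sub>o X) Y Z \<cdot> (minv C (\<a> W X Y) \<otimes>\<^sub>m \<iota> Z)
    = minv C (\<a> W X (Y \<otimes>\<^sub>o Z)) \<cdot> (\<iota> W \<otimes>\<^sub>m \<a> X Y Z) \<cdot> \<a> W (X \<otimes>\<^sub>o Y) Z"
proof -
  have "\<a> (W \<otimes>\<^sub>o X) Y Z \<cdot> (minv C (\<a> W X Y) \<otimes>\<^sub>m \<iota> Z)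
    = minv C (\<a> W X (Y \<otimes>\<^sub>o Z)) \<cdot> (\<a> W X (Y \<otimes>\<^sub>o Z) \<cdot> \<a> (W \<otimes>\<^sub>o X) Y Z) \<cdot> minv C (\<a> W X Y \<otimes>\<^sub>m \<iota> Z)"
    using assms by (simp add: assoc_cmp)
  also have "\<dots> = minv C (\<a> W X (Y \<otimes>\<^sub>o Z)) \<cdot> (\<iota> W \<otimes>\<^sub>m \<a> X Y Z) \<cdot> \<a> W (X \<otimes>\<^sub>o Y) Z"
    unfolding pentagon[OF assms] using assms by (simp add: assoc_cmp del: iso_tens(2))
  finally show ?thesis .
qed

text \<open>The mate of \<open>b'\<close> under the duality of \<open>X\<close> and
  \<open>Y\<close>, as in the inner part of \<open>fs_D\<close>. If \<open>b'\<close> is a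
  coevaluation for \<open>Z\<close>, this is the comparison map Y \<rightarrow> Z between two left
  duals of \<open>X\<close>.\<close>

definition dual_map :: "'o \<Rightarrow> 'o \<Rightarrow> 'o \<Rightarrow> 'm \<Rightarrow> 'm \<Rightarrow> 'm" where
  "dual_map X Y Z d b' = (d \<otimes>\<^sub>m \<iota> Z) \<cdot> minv C (\<a> Y X Z) \<cdot> (\<iota> Y \<otimes>\<^sub>m b')"

lemma dual_simps:
  assumes "is_left_dual C X Y d b"
  shows "X \<in> Ob C" "Y \<in> Ob C" "d \<in> Mor C" "Dom C d = Y \<otimes>\<^sub>o X" "Cod C d = \<^bold>1"
    "b \<in> Mor C" "Dom C b = \<^bold>1" "Cod C b = X \<otimes>\<^sub>o Y"
  using assms by (auto simp: is_left_dual_def Hom_iff)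

lemma dual_zigzag:
  assumes "is_left_dual C X Y d b"
  shows "(\<iota> X \<otimes>\<^sub>m d) \<cdot> \<a> X Y X \<cdot> (b \<otimes>\<^sub>m \<iota> X) = \<iota> X"
    "(d \<otimes>\<^sub>m \<iota> Y) \<cdot> minv C (\<a> Y X Y) \<cdot> (\<iota> Y \<otimes>\<^sub>m b) = \<iota> Y"
  using assms by (auto simp: is_left_dual_def)

lemma dual_map_simps [simp]:
  assumes "is_left_dual C X Y d b" "is_left_dual C X Z d' b'"
  shows "dual_map X Y Z d b' \<in> Mor C" "Dom C (dual_map X Y Z d b') = Y" "Cod C (dual_map X Y Z d b') = Z"
  using dual_simps[OF assms(1)] dual_simps[OF assms(2)] by (simp_all add: dual_map_def)

text \<open>The morphisms \<open>b\<close> and \<open>b'\<close> act on separate tensor factors and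
  can be interchanged; afterwards the zigzag on \<open>X\<close> of the first dual cancels.\<close>

lemma coev_dual_map:
  assumes dual: "is_left_dual C X Y d b" and dual': "is_left_dual C X Z d' b'"
  shows "(\<iota> X \<otimes>\<^sub>m dual_map X Y Z d b') \<cdot> b = b'"
proof -
  note [simp] = dual_simps[OF dual] dual_simps[OF dual']
  have 1: "(\<iota> X \<otimes>\<^sub>m (\<iota> Y \<otimes>\<^sub>m b')) \<cdot> b = \<a> X Y (X \<otimes>\<^sub>o Z) \<cdot> (b \<otimes>\<^sub>m \<iota> (X \<otimes>\<^sub>o Z)) \<cdot> b'"
  proof -
    have "(\<iota> X \<otimes>\<^sub>m (\<iota> Y \<otimes>\<^sub>m b')) \<cdot> b = \<a> X Y (X \<otimes>\<^sub>o Z) \<cdot> (\<iota> (X \<otimes>\<^sub>o Y) \<otimes>\<^sub>m b') \<cdot> (b \<otimes>\<^sub>m \<iota> \<^bold>1)"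
      using assoc_nat[of "\<iota> X" "\<iota> Y" b'] by (simp add: assoc_cmp[symmetric] tens_idt)
    also have "(\<iota> (X \<otimes>\<^sub>o Y) \<otimes>\<^sub>m b') \<cdot> (b \<otimes>\<^sub>m \<iota> \<^bold>1) = (b \<otimes>\<^sub>m \<iota> (X \<otimes>\<^sub>o Z)) \<cdot> (\<iota> \<^bold>1 \<otimes>\<^sub>m b')"
      by (subst (1 2) cmp_tens) simp_all
    finally show ?thesis by simp
  qed
  have 2: "(\<iota> X \<otimes>\<^sub>m (d \<otimes>\<^sub>m \<iota> Z)) \<cdot> \<a> X (Y \<otimes>\<^sub>o X) Z = (\<iota> X \<otimes>\<^sub>m d) \<otimes>\<^sub>m \<iota> Z"
    using assoc_nat[of "\<iota> X" d "\<iota> Z"] by simp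
  have 3: "minv C (\<a> (X \<otimes>\<^sub>o Y) X Z) \<cdot> (b \<otimes>\<^sub>m \<iota> (X \<otimes>\<^sub>o Z)) = (b \<otimes>\<^sub>m \<iota> X) \<otimes>\<^sub>m \<iota> Z"
    using assoc_inv_nat[of b "\<iota> X" "\<iota> Z"] by (simp add: tens_idt)
  have "(\<iota> X \<otimes>\<^sub>m dual_map X Y Z d b') \<cdot> b
    = (\<iota> X \<otimes>\<^sub>m (d \<otimes>\<^sub>m \<iota> Z)) \<cdot> (\<iota> X \<otimes>\<^sub>m minv C (\<a> Y X Z)) \<cdot> (\<iota> X \<otimes>\<^sub>m (\<iota> Y \<otimes>\<^sub>m b')) \<cdot> b"
    by (simp add: dual_map_def cmp_tens assoc_cmp[symmetric])
  also have "\<dots> = (\<iota> X \<otimes>\<^sub>m (d \<otimes>\<^sub>m \<iota> Z)) \<cdot> ((\<iota> X \<otimes>\<^sub>m minv C (\<a> Y X Z)) \<cdot> \<a> X Y (X \<otimes>\<^sub>o Z)) \<cdot> (b \<otimes>\<^sub>m \<iota> (X \<otimes>\<^sub>o Z)) \<cdot> b'"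
    unfolding 1 by (simp add: assoc_cmp)
  also have "\<dots> = ((\<iota> X \<otimes>\<^sub>m (d \<otimes>\<^sub>m \<iota> Z)) \<cdot> \<a> X (Y \<otimes>\<^sub>o X) Z) \<cdot> (\<a> X Y X \<otimes>\<^sub>m \<iota> Z)
      \<cdot> (minv C (\<a> (X \<otimes>\<^sub>o Y) X Z) \<cdot> (b \<otimes>\<^sub>m \<iota> (X \<otimes>\<^sub>o Z))) \<cdot> b'"
    by (subst pentagon_left) (simp_all add: assoc_cmp)
  also have "\<dots> = (((\<iota> X \<otimes>\<^sub>m d) \<cdot> \<a> X Y X \<cdot> (b \<otimes>\<^sub>m \<iota> X)) \<otimes>\<^sub>m \<iota> Z) \<cdot> b'"
    unfolding 2 3 by (simp add: cmp_tens assoc_cmp[symmetric])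
  also have "\<dots> = b'" unfolding dual_zigzag[OF dual] by (simp add: tens_idt)
  finally show ?thesis .
qed

text \<open>The mirror image of \<open>coev_dual_map\<close>: now \<open>d\<close> and
  \<open>d'\<close> are interchanged, and the zigzag on \<open>X\<close> of the second dual
  cancels.\<close>

lemma ev_dual_map:
  assumes dual: "is_left_dual C X Y d b" and dual': "is_left_dual C X Z d' b'"
  shows "d' \<cdot> (dual_map X Y Z d b' \<otimes>\<^sub>m \<iota> X) = d"
proof -
  note [simp] = dual_simps[OF dual] dual_simps[OF dual']
  have 1: "d' \<cdot> ((d \<otimes>\<^sub>m \<iota> Z) \<otimes>\<^sub>m \<iota> X) = d \<cdot> (\<iota> (Y \<otimes>\<^sub>o X) \<otimes>\<^sub>m d') \<cdot> \<a> (Y \<otimes>\<^sub>o X) Z X"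
  proof -
    have "d' \<cdot> ((d \<otimes>\<^sub>m \<iota> Z) \<otimes>\<^sub>m \<iota> X) = (\<iota> \<^bold>1 \<otimes>\<^sub>m d') \<cdot> (d \<otimes>\<^sub>m \<iota> (Z \<otimes>\<^sub>o X)) \<cdot> \<a> (Y \<otimes>\<^sub>o X) Z X"
      using assoc_nat[of d "\<iota> Z" "\<iota> X"] by (simp add: tens_idt)
    also have "\<dots> = ((\<iota> \<^bold>1 \<otimes>\<^sub>m d') \<cdot> (d \<otimes>\<^sub>m \<iota> (Z \<otimes>\<^sub>o X))) \<cdot> \<a> (Y \<otimes>\<^sub>o X) Z X"
      by (subst assoc_cmp) simp_all
    also have "(\<iota> \<^bold>1 \<otimes>\<^sub>m d') \<cdot> (d \<otimes>\<^sub>m \<iota> (Z \<otimes>\<^sub>o X)) = (d \<otimes>\<^sub>m \<iota> \<^bold>1) \<cdot> (\<iota> (Y \<otimes>\<^sub>o X) \<otimes>\<^sub>m d')"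
      by (subst (1 2) cmp_tens) simp_all
    finally show ?thesis by (simp add: assoc_cmp)
  qed
  have 2: "\<a> Y (X \<otimes>\<^sub>o Z) X \<cdot> ((\<iota> Y \<otimes>\<^sub>m b') \<otimes>\<^sub>m \<iota> X) = \<iota> Y \<otimes>\<^sub>m (b' \<otimes>\<^sub>m \<iota> X)"
    using assoc_nat[of "\<iota> Y" b' "\<iota> X"] by simp
  have 3: "(\<iota> (Y \<otimes>\<^sub>o X) \<otimes>\<^sub>m d') \<cdot> minv C (\<a> Y X (Z \<otimes>\<^sub>o X)) = \<iota> Y \<otimes>\<^sub>m (\<iota> X \<otimes>\<^sub>m d')"
    using assoc_inv_nat[of "\<iota> Y" "\<iota> X" d'] by (simp add: tens_idt)
  have "d' \<cdot> (dual_map X Y Z d b' \<otimes>\<^sub>m \<iota> X)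
    = (d' \<cdot> ((d \<otimes>\<^sub>m \<iota> Z) \<otimes>\<^sub>m \<iota> X)) \<cdot> (minv C (\<a> Y X Z) \<otimes>\<^sub>m \<iota> X) \<cdot> ((\<iota> Y \<otimes>\<^sub>m b') \<otimes>\<^sub>m \<iota> X)"
    by (simp add: dual_map_def cmp_tens assoc_cmp)
  also have "\<dots> = d \<cdot> (\<iota> (Y \<otimes>\<^sub>o X) \<otimes>\<^sub>m d') \<cdot> (\<a> (Y \<otimes>\<^sub>o X) Z X \<cdot> (minv C (\<a> Y X Z) \<otimes>\<^sub>m \<iota> X)) \<cdot> ((\<iota> Y \<otimes>\<^sub>m b') \<otimes>\<^sub>m \<iota> X)"
    unfolding 1 by (simp add: assoc_cmp)
  also have "\<dots> = d \<cdot> ((\<iota> (Y \<otimes>\<^sub>o X) \<otimes>\<^sub>m d') \<cdot> minv C (\<a> Y X (Z \<otimes>\<^sub>o X))) \<cdot> (\<iota> Y \<otimes>\<^sub>m \<a> X Z X)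
      \<cdot> (\<a> Y (X \<otimes>\<^sub>o Z) X \<cdot> ((\<iota> Y \<otimes>\<^sub>m b') \<otimes>\<^sub>m \<iota> X))"
    by (subst pentagon_right) (simp_all add: assoc_cmp)
  also have "\<dots> = d \<cdot> (\<iota> Y \<otimes>\<^sub>m ((\<iota> X \<otimes>\<^sub>m d') \<cdot> \<a> X Z X \<cdot> (b' \<otimes>\<^sub>m \<iota> X)))"
    unfolding 2 3 by (simp add: cmp_tens assoc_cmp)
  also have "\<dots> = d" unfolding dual_zigzag[OF dual'] by (simp add: tens_idt)
  finally show ?thesis .
qed

text \<open>By the zigzag on \<open>Y\<close>, taking mates undoes
  \<open>x \<mapsto> (\<iota> X \<otimes>\<^sub>m x) \<cdot> b\<close>. So a morphism out of
  \<open>Y\<close> is determined by its effect on the coevaluation.\<close>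

lemma dual_map_coev:
  assumes dual: "is_left_dual C X Y d b" and x: "x \<in> Hom C Y Z"
  shows "dual_map X Y Z d ((\<iota> X \<otimes>\<^sub>m x) \<cdot> b) = x"
proof -
  note [simp] = dual_simps[OF dual]
  have [simp]: "x \<in> Mor C" "Dom C x = Y" "Cod C x = Z" "Z \<in> Ob C" using x by (auto simp: Hom_iff)
  have "dual_map X Y Z d ((\<iota> X \<otimes>\<^sub>m x) \<cdot> b)
    = (d \<otimes>\<^sub>m \<iota> Z) \<cdot> (minv C (\<a> Y X Z) \<cdot> (\<iota> Y \<otimes>\<^sub>m (\<iota> X \<otimes>\<^sub>m x))) \<cdot> (\<iota> Y \<otimes>\<^sub>m b)"
    by (simp add: dual_map_def cmp_tens assoc_cmp)
  also have "\<dots> = ((d \<otimes>\<^sub>m \<iota> Z) \<cdot> (\<iota> (Y \<otimes>\<^sub>o X) \<otimes>\<^sub>m x)) \<cdot> minv C (\<a> Y X Y) \<cdot> (\<iota> Y \<otimes>\<^sub>m b)"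
    using assoc_inv_nat[of "\<iota> Y" "\<iota> X" x] by (simp add: tens_idt assoc_cmp)
  also have "(d \<otimes>\<^sub>m \<iota> Z) \<cdot> (\<iota> (Y \<otimes>\<^sub>o X) \<otimes>\<^sub>m x) = (\<iota> \<^bold>1 \<otimes>\<^sub>m x) \<cdot> (d \<otimes>\<^sub>m \<iota> Y)"
    by (subst (1 2) cmp_tens) simp_all
  also have "((\<iota> \<^bold>1 \<otimes>\<^sub>m x) \<cdot> (d \<otimes>\<^sub>m \<iota> Y)) \<cdot> minv C (\<a> Y X Y) \<cdot> (\<iota> Y \<otimes>\<^sub>m b)
    = x \<cdot> (d \<otimes>\<^sub>m \<iota> Y) \<cdot> minv C (\<a> Y X Y) \<cdot> (\<iota> Y \<otimes>\<^sub>m b)"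
    by (simp add: assoc_cmp)
  also have "\<dots> = x" unfolding dual_zigzag[OF dual] by simp
  finally show ?thesis .
qed

text \<open>The composite and the identity have the same effect on \<open>b\<close>, and this effect
  determines a morphism out of \<open>Y\<close>.\<close>

lemma dual_map_inverse:
  assumes dual: "is_left_dual C X Y d b" and dual': "is_left_dual C X Z d' b'"
  shows "dual_map X Z Y d' b \<cdot> dual_map X Y Z d b' = \<iota> Y"
proof -
  note [simp] = dual_simps[OF dual] dual_simps[OF dual'] dual_map_simps[OF dual dual']
    dual_map_simps[OF dual' dual]
  let ?x = "dual_map X Z Y d' b \<cdot> dual_map X Y Z d b'"
  have "(\<iota> X \<otimes>\<^sub>m ?x) \<cdot> b = (\<iota> X \<otimes>\<^sub>m dual_map X Z Y d' b) \<cdot> (\<iota> X \<otimes>\<^sub>m dual_map X Y Z d b') \<cdot> b"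
    by (simp add: assoc_cmp[symmetric] cmp_tens)
  also have "\<dots> = (\<iota> X \<otimes>\<^sub>m \<iota> Y) \<cdot> b"
    by (simp add: coev_dual_map[OF dual dual'] coev_dual_map[OF dual' dual] tens_idt)
  finally have "dual_map X Y Y d ((\<iota> X \<otimes>\<^sub>m ?x) \<cdot> b) = dual_map X Y Y d ((\<iota> X \<otimes>\<^sub>m \<iota> Y) \<cdot> b)" by simp
  then show ?thesis
    by (subst (asm) (1 2) dual_map_coev[OF dual]) (simp_all add: Hom_iff)
qed

lemma iso_dual_map:
  assumes dual: "is_left_dual C X Y d b" and dual': "is_left_dual C X Z d' b'"
  shows "iso_mor C (dual_map X Y Z d b')"
  unfolding iso_mor_def mutually_inverse_def
  using dual_map_inverse[OF dual dual'] dual_map_inverse[OF dual' dual]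
    dual_map_simps[OF dual dual'] dual_map_simps[OF dual' dual]
  by (intro exI[of _ "dual_map X Z Y d' b"]) (simp add: Hom_iff)

end

section \<open>The comma category of a monoidal functor\<close>

context lin_functor
begin

lemma F_simps [simp]:
  assumes "f \<in> Mor C"
  shows "Fm f \<in> Mor D" "Dom D (Fm f) = Fo (Dom C f)" "Cod D (Fm f) = Fo (Cod C f)"
  using F_linear[of "Dom C f" "Cod C f"] assms by (simp_all add: linear_maps_iff Hom_iff)

lemma F_Ob [simp]: "X \<in> Ob C \<Longrightarrow> Fo X \<in> Ob D"
  by (fact F_in_Ob)

lemma F_idt_cmp [simp]:
  "X \<in> Ob C \<Longrightarrow> Fm (\<iota>\<^bsub>C\<^esub> X) = \<iota>\<^bsub>D\<^esub> (Fo X)"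
  "f \<in> Mor C \<Longrightarrow> g \<in> Mor C \<Longrightarrow> Cod C f = Dom C g \<Longrightarrow> Fm (g \<cdot>\<^bsub>C\<^esub> f) = Fm g \<cdot>\<^bsub>D\<^esub> Fm f"
  using F_cmp[of f "Dom C f" "Dom C g" g "Cod C g"] F_idt by (simp_all add: Hom_iff)

lemma F_scale [simp]:
  assumes "f \<in> Mor C"
  shows "Fm (mscale C c f) = mscale D c (Fm f)"
  using F_linear[of "Dom C f" "Cod C f"] assms by (simp add: linear_maps_iff Hom_iff)

lemma F_zero:
  assumes "X \<in> Ob C" "Y \<in> Ob C"
  shows "Fm (mzero C X Y) = mzero D (Fo X) (Fo Y)"
  using F_scale[of "mzero C X Y" 0] assms by simp

lemma F_iso [simp]:
  assumes "iso_mor C f"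
  shows "iso_mor D (Fm f)" "minv D (Fm f) = Fm (minv C f)"
proof -
  have "Fm (minv C f) \<cdot>\<^bsub>D\<^esub> Fm f = Fm (minv C f \<cdot>\<^bsub>C\<^esub> f)" "Fm f \<cdot>\<^bsub>D\<^esub> Fm (minv C f) = Fm (f \<cdot>\<^bsub>C\<^esub> minv C f)"
    using assms by (simp_all del: source.minv_simps(4,5))
  then have "mutually_inverse D (Fm f) (Fm (minv C f))"
    using assms by (simp add: mutually_inverse_def Hom_iff)
  then show "iso_mor D (Fm f)" "minv D (Fm f) = Fm (minv C f)"
    using target.minv_eqI by (auto simp: iso_mor_def)
qed

lemma F_isomorphic:
  assumes "isomorphic C X Y" shows "isomorphic D (Fo X) (Fo Y)"
proof -
  obtain f where "f \<in> Hom C X Y" "iso_mor C f" using assms by (auto simp: isomorphic_def)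
  then show ?thesis by (auto simp: isomorphic_def Hom_iff intro!: bexI[of _ "Fm f"])
qed

end

context monoidal_functor
begin

lemma F2_simps [simp]:
  assumes "X \<in> Ob C" "Y \<in> Ob C"
  shows "iso_mor D (F2 X Y)" "F2 X Y \<in> Mor D" "Dom D (F2 X Y) = Fo X \<otimes>\<^sub>o\<^bsub>D\<^esub> Fo Y"
    "Cod D (F2 X Y) = Fo (X \<otimes>\<^sub>o\<^bsub>C\<^esub> Y)"
  using F2_in_Hom[OF assms] F2_iso[OF assms] by (simp_all add: Hom_iff)

lemma F0_simps [simp]:
  "iso_mor D F0" "F0 \<in> Mor D" "Dom D F0 = \<^bold>1\<^bsub>D\<^esub>" "Cod D F0 = Fo \<^bold>1\<^bsub>C\<^esub>"
  using F0_in_Hom F0_iso by (simp_all add: Hom_iff)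

lemma F2_nat:
  assumes "f \<in> Mor C" "g \<in> Mor C"
  shows "F2 (Cod C f) (Cod C g) \<cdot>\<^bsub>D\<^esub> (Fm f \<otimes>\<^sub>m\<^bsub>D\<^esub> Fm g) = Fm (f \<otimes>\<^sub>m\<^bsub>C\<^esub> g) \<cdot>\<^bsub>D\<^esub> F2 (Dom C f) (Dom C g)"
  by (rule F2_natural) (use assms in \<open>simp_all add: Hom_iff\<close>)

text \<open>
  The comma category of \<open>D\<close> over \<open>F\<close>: an object is a morphism \<open>x : A \<rightarrow> F X\<close>, and
  \<open>square X x Y y f p\<close> says that \<open>(f, p)\<close> is a morphism from \<open>x\<close> to \<open>y\<close>.  It is monoidal with
  tensor product \<open>join\<close> and unit \<open>F0\<close>.
\<close>

definition over :: "'o \<Rightarrow> 'q \<Rightarrow> bool" where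
  "over X x \<longleftrightarrow> X \<in> Ob C \<and> x \<in> Mor D \<and> Cod D x = Fo X"

definition square :: "'o \<Rightarrow> 'q \<Rightarrow> 'o \<Rightarrow> 'q \<Rightarrow> 'm \<Rightarrow> 'q \<Rightarrow> bool" where
  "square X x Y y f p \<longleftrightarrow> over X x \<and> over Y y \<and> f \<in> Hom C X Y \<and> p \<in> Hom D (Dom D x) (Dom D y) \<and>
     y \<cdot>\<^bsub>D\<^esub> p = Fm f \<cdot>\<^bsub>D\<^esub> x"

definition join :: "'o \<Rightarrow> 'o \<Rightarrow> 'q \<Rightarrow> 'q \<Rightarrow> 'q" where
  "join X Y x y = F2 X Y \<cdot>\<^bsub>D\<^esub> (x \<otimes>\<^sub>m\<^bsub>D\<^esub> y)"

lemma over_simps: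
  assumes "over X x" shows "X \<in> Ob C" "x \<in> Mor D" "Cod D x = Fo X"
  using assms by (simp_all add: over_def)

lemma over_F0 [simp]: "over \<^bold>1\<^bsub>C\<^esub> F0"
  by (simp add: over_def)

lemma over_idt [simp]: "X \<in> Ob C \<Longrightarrow> over X (\<iota>\<^bsub>D\<^esub> (Fo X))"
  by (simp add: over_def)

lemma over_join [simp]:
  assumes "over X x" "over Y y"
  shows "over (X \<otimes>\<^sub>o\<^bsub>C\<^esub> Y) (join X Y x y)" "Dom D (join X Y x y) = Dom D x \<otimes>\<^sub>o\<^bsub>D\<^esub> Dom D y"
  using over_simps[OF assms(1)] over_simps[OF assms(2)] by (simp_all add: over_def join_def)

lemma iso_join [simp]:
  assumes "over X x" "over Y y" "iso_mor D x" "iso_mor D y"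
  shows "iso_mor D (join X Y x y)"
  using assms over_simps[OF assms(1)] over_simps[OF assms(2)] by (simp add: join_def)

text \<open>Strict units in \<open>D\<close> turn the unit constraints of \<open>F\<close> into
  equalities of objects of the comma category, so no unit isomorphisms appear in later
  squares.\<close>

lemma join_unit [simp]:
  assumes "over X x"
  shows "join \<^bold>1\<^bsub>C\<^esub> X F0 x = x" "join X \<^bold>1\<^bsub>C\<^esub> x F0 = x"
proof -
  note [simp] = over_simps[OF assms]
  have "join \<^bold>1\<^bsub>C\<^esub> X F0 x = (F2 \<^bold>1\<^bsub>C\<^esub> X \<cdot>\<^bsub>D\<^esub> (F0 \<otimes>\<^sub>m\<^bsub>D\<^esub> \<iota>\<^bsub>D\<^esub> (Fo X))) \<cdot>\<^bsub>D\<^esub> (\<iota>\<^bsub>D\<^esub> \<^bold>1\<^bsub>D\<^esub> \<otimes>\<^sub>m\<^bsub>D\<^esub> x)"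
    using assms by (simp add: join_def target.assoc_cmp target.cmp_tens del: target.tens_unit)
  then show "join \<^bold>1\<^bsub>C\<^esub> X F0 x = x" using assms by (simp add: F0_left)
  have "join X \<^bold>1\<^bsub>C\<^esub> x F0 = (F2 X \<^bold>1\<^bsub>C\<^esub> \<cdot>\<^bsub>D\<^esub> (\<iota>\<^bsub>D\<^esub> (Fo X) \<otimes>\<^sub>m\<^bsub>D\<^esub> F0)) \<cdot>\<^bsub>D\<^esub> (x \<otimes>\<^sub>m\<^bsub>D\<^esub> \<iota>\<^bsub>D\<^esub> \<^bold>1\<^bsub>D\<^esub>)"
    using assms by (simp add: join_def target.assoc_cmp target.cmp_tens del: target.tens_unit)
  then show "join X \<^bold>1\<^bsub>C\<^esub> x F0 = x" using assms by (simp add: F0_right)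
qed

lemma squareD:
  assumes "square X x Y y f p"
  shows "over X x" "over Y y" "X \<in> Ob C" "Y \<in> Ob C" "x \<in> Mor D" "y \<in> Mor D"
    "Cod D x = Fo X" "Cod D y = Fo Y" "f \<in> Mor C" "Dom C f = X" "Cod C f = Y"
    "p \<in> Mor D" "Dom D p = Dom D x" "Cod D p = Dom D y"
  using assms by (auto simp: square_def over_def Hom_iff)

lemma square_eq: "square X x Y y f p \<Longrightarrow> y \<cdot>\<^bsub>D\<^esub> p = Fm f \<cdot>\<^bsub>D\<^esub> x"
  by (simp add: square_def)

lemma square_idt: "over X x \<Longrightarrow> Dom D x = A \<Longrightarrow> square X x X x (\<iota>\<^bsub>C\<^esub> X) (\<iota>\<^bsub>D\<^esub> A)"
  by (auto simp: square_def over_def Hom_iff)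

lemma square_cmp:
  assumes g: "square Y y Z z g q" and f: "square X x Y y f p"
  shows "square X x Z z (g \<cdot>\<^bsub>C\<^esub> f) (q \<cdot>\<^bsub>D\<^esub> p)"
proof -
  note [simp] = squareD[OF f] squareD[OF g]
  have "z \<cdot>\<^bsub>D\<^esub> (q \<cdot>\<^bsub>D\<^esub> p) = Fm g \<cdot>\<^bsub>D\<^esub> (y \<cdot>\<^bsub>D\<^esub> p)"
    using square_eq[OF g] by (simp add: target.assoc_cmp[symmetric])
  also have "\<dots> = Fm (g \<cdot>\<^bsub>C\<^esub> f) \<cdot>\<^bsub>D\<^esub> x"
    using square_eq[OF f] by (simp add: target.assoc_cmp)
  finally show ?thesis by (simp add: square_def Hom_iff)
qed

lemma square_tens:
  assumes f: "square X x Y y f p" and g: "square X' x' Y' y' f' p'"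
  shows "square (X \<otimes>\<^sub>o\<^bsub>C\<^esub> X') (join X X' x x') (Y \<otimes>\<^sub>o\<^bsub>C\<^esub> Y') (join Y Y' y y') (f \<otimes>\<^sub>m\<^bsub>C\<^esub> f') (p \<otimes>\<^sub>m\<^bsub>D\<^esub> p')"
proof -
  note [simp] = squareD[OF f] squareD[OF g]
  have "join Y Y' y y' \<cdot>\<^bsub>D\<^esub> (p \<otimes>\<^sub>m\<^bsub>D\<^esub> p') = F2 Y Y' \<cdot>\<^bsub>D\<^esub> ((y \<cdot>\<^bsub>D\<^esub> p) \<otimes>\<^sub>m\<^bsub>D\<^esub> (y' \<cdot>\<^bsub>D\<^esub> p'))"
    by (simp add: join_def target.assoc_cmp target.cmp_tens)
  also have "\<dots> = (F2 Y Y' \<cdot>\<^bsub>D\<^esub> (Fm f \<otimes>\<^sub>m\<^bsub>D\<^esub> Fm f')) \<cdot>\<^bsub>D\<^esub> (x \<otimes>\<^sub>m\<^bsub>D\<^esub> x')"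
    by (simp add: square_eq[OF f] square_eq[OF g] target.assoc_cmp target.cmp_tens)
  also have "\<dots> = Fm (f \<otimes>\<^sub>m\<^bsub>C\<^esub> f') \<cdot>\<^bsub>D\<^esub> join X X' x x'"
    using F2_nat[of f f'] by (simp add: join_def target.assoc_cmp)
  finally show ?thesis by (simp add: square_def Hom_iff)
qed

text \<open>Coherence of \<open>F2\<close> treats the images under \<open>F\<close>; naturality of
  the associator of \<open>D\<close> moves it past \<open>x\<close>, \<open>y\<close> and
  \<open>z\<close>.\<close>

lemma square_assoc:
  assumes x: "over X x" and y: "over Y y" and z: "over Z z"
  shows "square ((X \<otimes>\<^sub>o\<^bsub>C\<^esub> Y) \<otimes>\<^sub>o\<^bsub>C\<^esub> Z) (join (X \<otimes>\<^sub>o\<^bsub>C\<^esub> Y) Z (join X Y x y) z)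
    (X \<otimes>\<^sub>o\<^bsub>C\<^esub> (Y \<otimes>\<^sub>o\<^bsub>C\<^esub> Z)) (join X (Y \<otimes>\<^sub>o\<^bsub>C\<^esub> Z) x (join Y Z y z))
    (\<a>\<^bsub>C\<^esub> X Y Z) (\<a>\<^bsub>D\<^esub> (Dom D x) (Dom D y) (Dom D z))"
proof -
  note [simp] = over_simps[OF x] over_simps[OF y] over_simps[OF z]
  have l: "join (X \<otimes>\<^sub>o\<^bsub>C\<^esub> Y) Z (join X Y x y) z
    = F2 (X \<otimes>\<^sub>o\<^bsub>C\<^esub> Y) Z \<cdot>\<^bsub>D\<^esub> (F2 X Y \<otimes>\<^sub>m\<^bsub>D\<^esub> \<iota>\<^bsub>D\<^esub> (Fo Z)) \<cdot>\<^bsub>D\<^esub> ((x \<otimes>\<^sub>m\<^bsub>D\<^esub> y) \<otimes>\<^sub>m\<^bsub>D\<^esub> z)"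
    by (simp add: join_def target.cmp_tens)
  have r: "join X (Y \<otimes>\<^sub>o\<^bsub>C\<^esub> Z) x (join Y Z y z)
    = F2 X (Y \<otimes>\<^sub>o\<^bsub>C\<^esub> Z) \<cdot>\<^bsub>D\<^esub> (\<iota>\<^bsub>D\<^esub> (Fo X) \<otimes>\<^sub>m\<^bsub>D\<^esub> F2 Y Z) \<cdot>\<^bsub>D\<^esub> (x \<otimes>\<^sub>m\<^bsub>D\<^esub> (y \<otimes>\<^sub>m\<^bsub>D\<^esub> z))"
    by (simp add: join_def target.cmp_tens)
  have "Fm (\<a>\<^bsub>C\<^esub> X Y Z) \<cdot>\<^bsub>D\<^esub> join (X \<otimes>\<^sub>o\<^bsub>C\<^esub> Y) Z (join X Y x y) z
    = (Fm (\<a>\<^bsub>C\<^esub> X Y Z) \<cdot>\<^bsub>D\<^esub> F2 (X \<otimes>\<^sub>o\<^bsub>C\<^esub> Y) Z \<cdot>\<^bsub>D\<^esub> (F2 X Y \<otimes>\<^sub>m\<^bsub>D\<^esub> \<iota>\<^bsub>D\<^esub> (Fo Z))) \<cdot>\<^bsub>D\<^esub> ((x \<otimes>\<^sub>m\<^bsub>D\<^esub> y) \<otimes>\<^sub>m\<^bsub>D\<^esub> z)"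
    unfolding l by (simp add: target.assoc_cmp)
  also have "\<dots> = F2 X (Y \<otimes>\<^sub>o\<^bsub>C\<^esub> Z) \<cdot>\<^bsub>D\<^esub> (\<iota>\<^bsub>D\<^esub> (Fo X) \<otimes>\<^sub>m\<^bsub>D\<^esub> F2 Y Z) \<cdot>\<^bsub>D\<^esub>
      (\<a>\<^bsub>D\<^esub> (Fo X) (Fo Y) (Fo Z) \<cdot>\<^bsub>D\<^esub> ((x \<otimes>\<^sub>m\<^bsub>D\<^esub> y) \<otimes>\<^sub>m\<^bsub>D\<^esub> z))"
    by (subst F2_assoc) (simp_all add: target.assoc_cmp)
  also have "\<dots> = join X (Y \<otimes>\<^sub>o\<^bsub>C\<^esub> Z) x (join Y Z y z) \<cdot>\<^bsub>D\<^esub> \<a>\<^bsub>D\<^esub> (Dom D x) (Dom D y) (Dom D z)"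
    unfolding r using target.assoc_nat[of x y z] by (simp add: target.assoc_cmp)
  finally show ?thesis using x y z by (simp add: square_def Hom_iff)
qed

lemma square_minv:
  assumes f: "square X x Y y f p" and iso: "iso_mor C f" "iso_mor D p"
  shows "square Y y X x (minv C f) (minv D p)"
proof -
  note [simp] = squareD[OF f]
  have "x \<cdot>\<^bsub>D\<^esub> minv D p = Fm (minv C f) \<cdot>\<^bsub>D\<^esub> (Fm f \<cdot>\<^bsub>D\<^esub> x) \<cdot>\<^bsub>D\<^esub> minv D p"
    using target.minv_cancel(1)[of "Fm f" "x \<cdot>\<^bsub>D\<^esub> minv D p"] iso by (simp add: target.assoc_cmp)
  also have "\<dots> = Fm (minv C f) \<cdot>\<^bsub>D\<^esub> y"
    unfolding square_eq[OF f, symmetric] using iso by (simp add: target.assoc_cmp)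
  finally show ?thesis using iso by (simp add: square_def Hom_iff)
qed

lemma square_assoc_inv:
  assumes x: "over X x" and y: "over Y y" and z: "over Z z"
  shows "square (X \<otimes>\<^sub>o\<^bsub>C\<^esub> (Y \<otimes>\<^sub>o\<^bsub>C\<^esub> Z)) (join X (Y \<otimes>\<^sub>o\<^bsub>C\<^esub> Z) x (join Y Z y z))
    ((X \<otimes>\<^sub>o\<^bsub>C\<^esub> Y) \<otimes>\<^sub>o\<^bsub>C\<^esub> Z) (join (X \<otimes>\<^sub>o\<^bsub>C\<^esub> Y) Z (join X Y x y) z)
    (minv C (\<a>\<^bsub>C\<^esub> X Y Z)) (minv D (\<a>\<^bsub>D\<^esub> (Dom D x) (Dom D y) (Dom D z)))"
  using square_minv[OF square_assoc[OF assms]] over_simps[OF x] over_simps[OF y] over_simps[OF z] by simp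

text \<open>The isomorphism \<open>y\<close> cancels. This is how equations in \<open>D\<close> are
  obtained: two squares are constructed over one morphism of \<open>C\<close>.\<close>

lemma square_unique:
  assumes "square X x Y y f p" "square X x Y y f q" "iso_mor D y"
  shows "p = q"
  using target.iso_left_cancel[OF assms(3), of p q] squareD[OF assms(1)] squareD[OF assms(2)]
    square_eq[OF assms(1)] square_eq[OF assms(2)] by simp

lemma square_fill:
  assumes "over X x" "over Y y" "iso_mor D y" "f \<in> Hom C X Y"
  shows "square X x Y y f (minv D y \<cdot>\<^bsub>D\<^esub> Fm f \<cdot>\<^bsub>D\<^esub> x)"
  using assms over_simps[OF assms(1)] over_simps[OF assms(2)] by (simp add: square_def Hom_iff)

lemma square_id_unique: "square X x X x (\<iota>\<^bsub>C\<^esub> X) p \<Longrightarrow> iso_mor D x \<Longrightarrow> p = \<iota>\<^bsub>D\<^esub> (Dom D x)"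
  by (rule square_unique[OF _ square_idt]) (auto dest: squareD)

text \<open>
  The zigzag identities hold because the zigzag composites are squares over identities.
\<close>

lemma transport_left_dual:
  assumes dual: "is_left_dual C V V' d b" and t: "over V t" "iso_mor D t"
    and u: "over V' u" "iso_mor D u"
    and d: "square (V' \<otimes>\<^sub>o\<^bsub>C\<^esub> V) (join V' V u t) \<^bold>1\<^bsub>C\<^esub> F0 d e"
    and b: "square \<^bold>1\<^bsub>C\<^esub> F0 (V \<otimes>\<^sub>o\<^bsub>C\<^esub> V') (join V V' t u) b c"
  shows "is_left_dual D (Dom D t) (Dom D u) e c"
proof -
  note [simp] = source.dual_simps[OF dual] t u over_simps[OF t(1)] over_simps[OF u(1)]
  have "square (\<^bold>1\<^bsub>C\<^esub> \<otimes>\<^sub>o\<^bsub>C\<^esub> V) (join \<^bold>1\<^bsub>C\<^esub> V F0 t) (V \<otimes>\<^sub>o\<^bsub>C\<^esub> \<^bold>1\<^bsub>C\<^esub>) (join V \<^bold>1\<^bsub>C\<^esub> t F0)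
    ((\<iota>\<^bsub>C\<^esub> V \<otimes>\<^sub>m\<^bsub>C\<^esub> d) \<cdot>\<^bsub>C\<^esub> \<a>\<^bsub>C\<^esub> V V' V \<cdot>\<^bsub>C\<^esub> (b \<otimes>\<^sub>m\<^bsub>C\<^esub> \<iota>\<^bsub>C\<^esub> V))
    ((\<iota>\<^bsub>D\<^esub> (Dom D t) \<otimes>\<^sub>m\<^bsub>D\<^esub> e) \<cdot>\<^bsub>D\<^esub> \<a>\<^bsub>D\<^esub> (Dom D t) (Dom D u) (Dom D t) \<cdot>\<^bsub>D\<^esub> (c \<otimes>\<^sub>m\<^bsub>D\<^esub> \<iota>\<^bsub>D\<^esub> (Dom D t)))"
    by (rule d b square_assoc square_idt square_tens square_cmp | simp)+
  then have 1: "(\<iota>\<^bsub>D\<^esub> (Dom D t) \<otimes>\<^sub>m\<^bsub>D\<^esub> e) \<cdot>\<^bsub>D\<^esub> \<a>\<^bsub>D\<^esub> (Dom D t) (Dom D u) (Dom D t) \<cdot>\<^bsub>D\<^esub> (c \<otimes>\<^sub>m\<^bsub>D\<^esub> \<iota>\<^bsub>D\<^esub> (Dom D t))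
    = \<iota>\<^bsub>D\<^esub> (Dom D t)"
    by (intro square_id_unique[of V]) (simp_all add: source.dual_zigzag[OF dual])
  have "square (V' \<otimes>\<^sub>o\<^bsub>C\<^esub> \<^bold>1\<^bsub>C\<^esub>) (join V' \<^bold>1\<^bsub>C\<^esub> u F0) (\<^bold>1\<^bsub>C\<^esub> \<otimes>\<^sub>o\<^bsub>C\<^esub> V') (join \<^bold>1\<^bsub>C\<^esub> V' F0 u)
    ((d \<otimes>\<^sub>m\<^bsub>C\<^esub> \<iota>\<^bsub>C\<^esub> V') \<cdot>\<^bsub>C\<^esub> minv C (\<a>\<^bsub>C\<^esub> V' V V') \<cdot>\<^bsub>C\<^esub> (\<iota>\<^bsub>C\<^esub> V' \<otimes>\<^sub>m\<^bsub>C\<^esub> b))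
    ((e \<otimes>\<^sub>m\<^bsub>D\<^esub> \<iota>\<^bsub>D\<^esub> (Dom D u)) \<cdot>\<^bsub>D\<^esub> minv D (\<a>\<^bsub>D\<^esub> (Dom D u) (Dom D t) (Dom D u)) \<cdot>\<^bsub>D\<^esub> (\<iota>\<^bsub>D\<^esub> (Dom D u) \<otimes>\<^sub>m\<^bsub>D\<^esub> c))"
    by (rule d b square_assoc_inv square_idt square_tens square_cmp | simp)+
  then have 2: "(e \<otimes>\<^sub>m\<^bsub>D\<^esub> \<iota>\<^bsub>D\<^esub> (Dom D u)) \<cdot>\<^bsub>D\<^esub> minv D (\<a>\<^bsub>D\<^esub> (Dom D u) (Dom D t) (Dom D u)) \<cdot>\<^bsub>D\<^esub> (\<iota>\<^bsub>D\<^esub> (Dom D u) \<otimes>\<^sub>m\<^bsub>D\<^esub> c)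
    = \<iota>\<^bsub>D\<^esub> (Dom D u)"
    by (intro square_id_unique[of V']) (simp_all add: source.dual_zigzag[OF dual])
  show ?thesis using 1 2 squareD[OF d] squareD[OF b] by (simp add: is_left_dual_def Hom_iff)
qed

text \<open>Over \<open>V'\<close>, the identity of \<open>Fo V'\<close> comes first: filling
  squares makes \<open>Fo V'\<close> a left dual of \<open>W\<close> with some \<open>e\<close> and
  \<open>c\<close>. The comparison map of duals in \<open>D\<close> then leads from
  \<open>W'\<close> to \<open>Fo V'\<close> and matches \<open>e\<close>, \<open>c\<close> with the
  prescribed \<open>d'\<close>, \<open>b'\<close> exactly.\<close>

lemma dual_over:
  assumes dual: "is_left_dual C V V' d b" and dual': "is_left_dual D W W' d' b'"
    and t: "over V t" "iso_mor D t" "Dom D t = W"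
  obtains s where "over V' s" "iso_mor D s" "Dom D s = W'"
    "square (V' \<otimes>\<^sub>o\<^bsub>C\<^esub> V) (join V' V s t) \<^bold>1\<^bsub>C\<^esub> F0 d d'"
    "square \<^bold>1\<^bsub>C\<^esub> F0 (V \<otimes>\<^sub>o\<^bsub>C\<^esub> V') (join V V' t s) b b'"
proof -
  note [simp] = source.dual_simps[OF dual] target.dual_simps[OF dual'] t over_simps[OF t(1)]
  let ?u = "\<iota>\<^bsub>D\<^esub> (Fo V')"
  have "\<exists>e. square (V' \<otimes>\<^sub>o\<^bsub>C\<^esub> V) (join V' V ?u t) \<^bold>1\<^bsub>C\<^esub> F0 d e"
    by (rule exI, rule square_fill) (simp_all add: Hom_iff)
  then obtain e where e: "square (V' \<otimes>\<^sub>o\<^bsub>C\<^esub> V) (join V' V ?u t) \<^bold>1\<^bsub>C\<^esub> F0 d e" by blast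
  have "\<exists>c. square \<^bold>1\<^bsub>C\<^esub> F0 (V \<otimes>\<^sub>o\<^bsub>C\<^esub> V') (join V V' t ?u) b c"
    by (rule exI, rule square_fill) (simp_all add: Hom_iff)
  then obtain c where c: "square \<^bold>1\<^bsub>C\<^esub> F0 (V \<otimes>\<^sub>o\<^bsub>C\<^esub> V') (join V V' t ?u) b c" by blast
  have dual'': "is_left_dual D W (Fo V') e c"
    using transport_left_dual[OF dual t(1,2) _ _ e c] by simp
  define s where "s = target.dual_map W W' (Fo V') d' c"
  note s_simps [simp] = target.dual_map_simps[OF dual' dual'', folded s_def]
  have iso [simp]: "iso_mor D s"
    unfolding s_def by (rule target.iso_dual_map[OF dual' dual''])
  have over [simp]: "over V' s" by (simp add: over_def)
  \<comment> \<open>As a square over the identity, \<open>s\<close> changes the object chosen over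
    \<open>V'\<close>.\<close>
  have s: "square V' s V' ?u (\<iota>\<^bsub>C\<^esub> V') s" by (simp add: square_def Hom_iff)
  have "square (V' \<otimes>\<^sub>o\<^bsub>C\<^esub> V) (join V' V s t) \<^bold>1\<^bsub>C\<^esub> F0 (d \<cdot>\<^bsub>C\<^esub> (\<iota>\<^bsub>C\<^esub> V' \<otimes>\<^sub>m\<^bsub>C\<^esub> \<iota>\<^bsub>C\<^esub> V)) (e \<cdot>\<^bsub>D\<^esub> (s \<otimes>\<^sub>m\<^bsub>D\<^esub> \<iota>\<^bsub>D\<^esub> W))"
    by (rule s square_idt square_tens square_cmp[OF e] | simp)+
  then have "square (V' \<otimes>\<^sub>o\<^bsub>C\<^esub> V) (join V' V s t) \<^bold>1\<^bsub>C\<^esub> F0 d d'"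
    unfolding s_def target.ev_dual_map[OF dual' dual''] by (simp add: source.tens_idt)
  \<comment> \<open>Composing squares would require the inverse of \<open>s\<close> here; factoring
    \<open>join\<close> through \<open>s\<close> avoids it.\<close>
  moreover have "square \<^bold>1\<^bsub>C\<^esub> F0 (V \<otimes>\<^sub>o\<^bsub>C\<^esub> V') (join V V' t s) b b'"
  proof -
    have "join V V' t s = join V V' t ?u \<cdot>\<^bsub>D\<^esub> (\<iota>\<^bsub>D\<^esub> W \<otimes>\<^sub>m\<^bsub>D\<^esub> s)"
      by (simp add: join_def target.assoc_cmp target.cmp_tens)
    then have "join V V' t s \<cdot>\<^bsub>D\<^esub> b' = join V V' t ?u \<cdot>\<^bsub>D\<^esub> ((\<iota>\<^bsub>D\<^esub> W \<otimes>\<^sub>m\<^bsub>D\<^esub> s) \<cdot>\<^bsub>D\<^esub> b')"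
      by (simp add: target.assoc_cmp)
    also have "\<dots> = Fm b \<cdot>\<^bsub>D\<^esub> F0"
      unfolding s_def target.coev_dual_map[OF dual' dual''] by (rule square_eq[OF c])
    finally show ?thesis by (simp add: square_def Hom_iff)
  qed
  ultimately show ?thesis using that[of s] by simp
qed

end

section \<open>Equivalences and simple objects\<close>

lemma (in lin_category) mono_cmp_iso:
  assumes "is_mono C i" "iso_mor C e" "Cod C i = Dom C e"
  shows "is_mono C (e \<cdot> i)"
  unfolding is_mono_def
proof (intro conjI allI ballI impI)
  have i: "i \<in> Mor C" using assms by (simp add: is_mono_def)
  then show "e \<cdot> i \<in> Mor C" using assms by simp
  fix W g h assume g: "g \<in> Hom C W (Dom C (e \<cdot> i))" and h: "h \<in> Hom C W (Dom C (e \<cdot> i))"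
    and eq: "(e \<cdot> i) \<cdot> g = (e \<cdot> i) \<cdot> h"
  have "i \<cdot> g = i \<cdot> h"
    by (rule iso_left_cancel[OF assms(2)])
      (use g h i eq assms in \<open>auto simp: Hom_iff assoc_cmp\<close>)
  then show "g = h" using assms g h i by (auto simp: is_mono_def)
qed

text \<open>Naturality of \<eta> expresses \<open>h\<close> by a formula in which it occurs only
  through \<open>Fm h\<close>.\<close>

lemma retract_faithful:
  assumes F: "lin_functor C D Fo Fm" and G: "lin_functor D C Go Gm"
    and \<eta>: "natural_iso C C (Go \<circ> Fo) (Gm \<circ> Fm) id id \<eta>"
    and fg: "f \<in> Hom C X Y" "g \<in> Hom C X Y" "Fm f = Fm g"
  shows "f = g"
proof -
  interpret F: lin_functor C D Fo Fm by (fact F)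
  interpret G: lin_functor D C Go Gm by (fact G)
  have X: "X \<in> Ob C" "Y \<in> Ob C" using fg by (auto simp: Hom_iff)
  have \<eta>X: "\<eta> X \<in> Hom C (Go (Fo X)) X" "iso_mor C (\<eta> X)"
    using \<eta> X by (auto simp: natural_iso_def)
  have "h = (\<eta> Y \<cdot>\<^bsub>C\<^esub> Gm (Fm h)) \<cdot>\<^bsub>C\<^esub> minv C (\<eta> X)" if h: "h \<in> Hom C X Y" for h
  proof -
    have "\<eta> Y \<cdot>\<^bsub>C\<^esub> Gm (Fm h) = h \<cdot>\<^bsub>C\<^esub> \<eta> X" using \<eta> h by (simp add: natural_iso_def)
    then show ?thesis using h \<eta>X by (simp add: F.source.assoc_cmp Hom_iff)
  qed
  then show ?thesis using fg by metis
qed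

text \<open>The candidate is the formula from \<open>retract_faithful\<close> with \<open>h\<close>
  in place of \<open>Fm f\<close>. It yields only \<open>Gm (Fm f) = Gm h\<close>; faithfulness of
  \<open>G\<close>, which is the same lemma with the roles exchanged, removes
  \<open>Gm\<close>.\<close>

lemma retract_full:
  assumes F: "lin_functor C D Fo Fm" and G: "lin_functor D C Go Gm"
    and \<eta>: "natural_iso C C (Go \<circ> Fo) (Gm \<circ> Fm) id id \<eta>"
    and \<epsilon>: "natural_iso D D (Fo \<circ> Go) (Fm \<circ> Gm) id id \<epsilon>"
    and X: "X \<in> Ob C" "Y \<in> Ob C" and h: "h \<in> Hom D (Fo X) (Fo Y)"
  obtains f where "f \<in> Hom C X Y" "Fm f = h"
proof -
  interpret F: lin_functor C D Fo Fm by (fact F)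
  interpret G: lin_functor D C Go Gm by (fact G)
  have \<eta>X: "\<eta> X \<in> Hom C (Go (Fo X)) X" "iso_mor C (\<eta> X)"
    "\<eta> Y \<in> Hom C (Go (Fo Y)) Y" "iso_mor C (\<eta> Y)"
    using \<eta> X by (auto simp: natural_iso_def)
  define f where "f = (\<eta> Y \<cdot>\<^bsub>C\<^esub> Gm h) \<cdot>\<^bsub>C\<^esub> minv C (\<eta> X)"
  have f: "f \<in> Hom C X Y" using \<eta>X h by (simp add: f_def Hom_iff)
  have "\<eta> Y \<cdot>\<^bsub>C\<^esub> Gm (Fm f) = f \<cdot>\<^bsub>C\<^esub> \<eta> X" using \<eta> f by (simp add: natural_iso_def)
  also have "\<dots> = \<eta> Y \<cdot>\<^bsub>C\<^esub> Gm h" using \<eta>X h by (simp add: f_def F.source.assoc_cmp Hom_iff)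
  finally have "Gm (Fm f) = Gm h"
    by (rule F.source.iso_left_cancel[OF \<eta>X(4)]) (use \<eta>X f h X in \<open>auto simp: Hom_iff\<close>)
  then have "Fm f = h"
    by (intro retract_faithful[OF G F \<epsilon>, of _ "Fo X" "Fo Y"]) (use f h in \<open>auto simp: Hom_iff\<close>)
  with f show ?thesis by (rule that)
qed

lemma equivalence_inverse:
  assumes "is_equivalence C D Fo Fm"
  obtains Go Gm where "is_equivalence D C Go Gm"
    "\<And>X. X \<in> Ob C \<Longrightarrow> isomorphic C (Go (Fo X)) X" "\<And>Y. Y \<in> Ob D \<Longrightarrow> isomorphic D (Fo (Go Y)) Y"
proof -
  obtain Go Gm \<eta> \<epsilon> where F: "lin_functor C D Fo Fm" and G: "lin_functor D C Go Gm"
    and \<eta>: "natural_iso C C (Go \<circ> Fo) (Gm \<circ> Fm) id id \<eta>"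
    and \<epsilon>: "natural_iso D D (Fo \<circ> Go) (Fm \<circ> Gm) id id \<epsilon>"
    using assms by (auto simp: is_equivalence_def)
  show ?thesis
  proof
    show "is_equivalence D C Go Gm" unfolding is_equivalence_def using F G \<eta> \<epsilon> by blast
    show "isomorphic C (Go (Fo X)) X" if "X \<in> Ob C" for X
      using \<eta> that by (auto simp: natural_iso_def isomorphic_def)
    show "isomorphic D (Fo (Go Y)) Y" if "Y \<in> Ob D" for Y
      using \<epsilon> that by (auto simp: natural_iso_def isomorphic_def)
  qed
qed

locale lin_equivalence = lin_functor +
  assumes equivalence: "is_equivalence C D Fo Fm"
begin

lemma faithful:
  assumes "f \<in> Hom C X Y" "g \<in> Hom C X Y" "Fm f = Fm g"
  shows "f = g"
  using equivalence retract_faithful[OF _ _ _ assms] by (auto simp: is_equivalence_def)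

lemma full:
  assumes "X \<in> Ob C" "Y \<in> Ob C" "h \<in> Hom D (Fo X) (Fo Y)"
  obtains f where "f \<in> Hom C X Y" "Fm f = h"
proof -
  obtain Go Gm \<eta> \<epsilon> where "lin_functor C D Fo Fm" "lin_functor D C Go Gm"
    "natural_iso C C (Go \<circ> Fo) (Gm \<circ> Fm) id id \<eta>" "natural_iso D D (Fo \<circ> Go) (Fm \<circ> Gm) id id \<epsilon>"
    using equivalence by (auto simp: is_equivalence_def)
  then show ?thesis using retract_full[OF _ _ _ _ assms] that by metis
qed

lemma reflects_iso:
  assumes "f \<in> Mor C" "iso_mor D (Fm f)"
  shows "iso_mor C f"
proof -
  obtain g where g: "g \<in> Hom C (Cod C f) (Dom C f)" "Fm g = minv D (Fm f)"
    by (rule full[of "Cod C f" "Dom C f" "minv D (Fm f)"]) (use assms in \<open>auto simp: Hom_iff\<close>)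
  have "g \<cdot>\<^bsub>C\<^esub> f = \<iota>\<^bsub>C\<^esub> (Dom C f)" "f \<cdot>\<^bsub>C\<^esub> g = \<iota>\<^bsub>C\<^esub> (Cod C f)"
    by (rule faithful; use assms g in \<open>simp add: Hom_iff\<close>)+
  then show ?thesis using assms g by (auto simp: iso_mor_def mutually_inverse_def)
qed

lemma reflects_isomorphic:
  assumes "X \<in> Ob C" "Y \<in> Ob C" "isomorphic D (Fo X) (Fo Y)"
  shows "isomorphic C X Y"
proof -
  obtain h where h: "h \<in> Hom D (Fo X) (Fo Y)" "iso_mor D h" using assms(3) by (auto simp: isomorphic_def)
  obtain f where f: "f \<in> Hom C X Y" "Fm f = h" using full[OF assms(1,2) h(1)] .
  then show ?thesis using reflects_iso[of f] h by (auto simp: isomorphic_def Hom_iff)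
qed

text \<open>A test object \<open>A\<close> is replaced by an isomorphic \<open>Fo X\<close>; the
  test morphisms then lift to \<open>C\<close> by fullness.\<close>

lemma preserves_mono:
  assumes mono: "is_mono C i" and equiv: "\<And>A. A \<in> Ob D \<Longrightarrow> \<exists>X \<in> Ob C. isomorphic D (Fo X) A"
  shows "is_mono D (Fm i)"
  unfolding is_mono_def
proof (intro conjI allI ballI impI)
  have i: "i \<in> Mor C" using mono by (simp add: is_mono_def)
  then show "Fm i \<in> Mor D" by simp
  fix A g h assume g: "g \<in> Hom D A (Dom D (Fm i))" and h: "h \<in> Hom D A (Dom D (Fm i))"
    and eq: "Fm i \<cdot>\<^bsub>D\<^esub> g = Fm i \<cdot>\<^bsub>D\<^esub> h"
  have "A \<in> Ob D" using g by (auto simp: Hom_iff)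
  then obtain X e where X: "X \<in> Ob C" and e: "e \<in> Hom D (Fo X) A" "iso_mor D e"
    using equiv by (meson isomorphic_def)
  obtain g' where g': "g' \<in> Hom C X (Dom C i)" "Fm g' = g \<cdot>\<^bsub>D\<^esub> e"
    by (rule full[of X "Dom C i" "g \<cdot>\<^bsub>D\<^esub> e"]) (use X i g e in \<open>auto simp: Hom_iff\<close>)
  obtain h' where h': "h' \<in> Hom C X (Dom C i)" "Fm h' = h \<cdot>\<^bsub>D\<^esub> e"
    by (rule full[of X "Dom C i" "h \<cdot>\<^bsub>D\<^esub> e"]) (use X i h e in \<open>auto simp: Hom_iff\<close>)
  have "(Fm i \<cdot>\<^bsub>D\<^esub> g) \<cdot>\<^bsub>D\<^esub> e = (Fm i \<cdot>\<^bsub>D\<^esub> h) \<cdot>\<^bsub>D\<^esub> e" by (simp add: eq)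
  then have "Fm i \<cdot>\<^bsub>D\<^esub> (g \<cdot>\<^bsub>D\<^esub> e) = Fm i \<cdot>\<^bsub>D\<^esub> (h \<cdot>\<^bsub>D\<^esub> e)"
    using g h e i by (simp add: target.assoc_cmp Hom_iff)
  then have "i \<cdot>\<^bsub>C\<^esub> g' = i \<cdot>\<^bsub>C\<^esub> h'"
    by (intro faithful[of _ X "Cod C i"]) (use g' h' i in \<open>auto simp: Hom_iff\<close>)
  then have "g' = h'" using mono g' h' by (auto simp: is_mono_def)
  then have "(g \<cdot>\<^bsub>D\<^esub> e) \<cdot>\<^bsub>D\<^esub> minv D e = (h \<cdot>\<^bsub>D\<^esub> e) \<cdot>\<^bsub>D\<^esub> minv D e" using g' h' by simp
  then show "g = h" using g h e by (simp add: target.assoc_cmp Hom_iff)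
qed

end

text \<open>Subobjects of \<open>Fo V\<close> are judged in \<open>C\<close>: a quasi-inverse
  followed by an isomorphism \<open>e\<close> turns \<open>i\<close> into a subobject of
  \<open>V\<close>, and being zero or invertible is reflected back.\<close>

lemma equivalence_preserves_simple:
  assumes equiv: "is_equivalence C D Fo Fm" and simple: "is_simple C V"
  shows "is_simple D (Fo V)"
  unfolding is_simple_def
proof (intro conjI allI ballI impI)
  interpret F: lin_equivalence C D Fo Fm
    using equiv by (simp add: lin_equivalence_def lin_equivalence_axioms_def is_equivalence_def)
  obtain Go Gm where G: "is_equivalence D C Go Gm" and GF: "\<And>X. X \<in> Ob C \<Longrightarrow> isomorphic C (Go (Fo X)) X"
    using equivalence_inverse[OF equiv] by metis
  interpret G: lin_equivalence D C Go Gm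
    using G by (simp add: lin_equivalence_def lin_equivalence_axioms_def is_equivalence_def)
  have V: "V \<in> Ob C" "\<iota>\<^bsub>C\<^esub> V \<noteq> mzero C V V"
    and sub: "\<And>Y i. i \<in> Hom C Y V \<Longrightarrow> is_mono C i \<Longrightarrow> i = mzero C Y V \<or> iso_mor C i"
    using simple by (auto simp: is_simple_def)
  show "Fo V \<in> Ob D" using V by simp
  show "\<iota>\<^bsub>D\<^esub> (Fo V) \<noteq> mzero D (Fo V) (Fo V)"
    using F.faithful[of "\<iota>\<^bsub>C\<^esub> V" V V "mzero C V V"] V by (auto simp: Hom_iff F.F_zero)
  fix Y i assume i: "i \<in> Hom D Y (Fo V)" and mono: "is_mono D i"
  obtain e where e: "e \<in> Hom C (Go (Fo V)) V" "iso_mor C e"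
    using GF[OF V(1)] by (auto simp: isomorphic_def)
  have Y: "Y \<in> Ob D" using i by (auto simp: Hom_iff)
  have "is_mono C (Gm i)"
    by (rule G.preserves_mono[OF mono]) (use GF in \<open>auto intro!: bexI[of _ "Fo A" for A]\<close>)
  then have "is_mono C (e \<cdot>\<^bsub>C\<^esub> Gm i)"
    by (rule F.source.mono_cmp_iso) (use e i in \<open>simp_all add: Hom_iff\<close>)
  moreover have ei: "e \<cdot>\<^bsub>C\<^esub> Gm i \<in> Hom C (Go Y) V" using e i by (simp add: Hom_iff)
  ultimately consider "e \<cdot>\<^bsub>C\<^esub> Gm i = mzero C (Go Y) V" | "iso_mor C (e \<cdot>\<^bsub>C\<^esub> Gm i)"
    using sub by blast
  then show "i = mzero D Y (Fo V) \<or> iso_mor D i"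
  proof cases
    case 1
    have "Gm i = mzero C (Go Y) (Go (Fo V))"
      by (rule F.source.iso_left_cancel[OF e(2)])
        (use e i V Y 1 in \<open>auto simp: Hom_iff F.source.cmp_zero\<close>)
    then have "Gm i = Gm (mzero D Y (Fo V))" using V Y by (simp add: G.F_zero)
    then have "i = mzero D Y (Fo V)"
      by (intro G.faithful[of _ Y "Fo V"]) (use i V Y in \<open>auto simp: Hom_iff\<close>)
    then show ?thesis ..
  next
    case 2
    have "iso_mor C (minv C e \<cdot>\<^bsub>C\<^esub> (e \<cdot>\<^bsub>C\<^esub> Gm i))"
      by (rule F.source.iso_cmp) (use 2 e i in \<open>auto simp: Hom_iff\<close>)
    then have "iso_mor C (Gm i)" using e i by (simp add: Hom_iff)
    then show ?thesis using G.reflects_iso i by (auto simp: Hom_iff)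
  qed
qed

section \<open>Comparison of pivotal structures\<close>

lemma (in pivotal_fusion_category) dual_facts [simp]:
  assumes "X \<in> Ob C"
  shows "dual C X \<in> Ob C" "ev C X \<in> Mor C" "Dom C (ev C X) = dual C X \<otimes>\<^sub>o X" "Cod C (ev C X) = \<^bold>1"
    "coev C X \<in> Mor C" "Dom C (coev C X) = \<^bold>1" "Cod C (coev C X) = X \<otimes>\<^sub>o dual C X"
  using dual_simps[OF chosen_left_dual[OF assms]] by auto

lemma (in pivotal_fusion_category) piv_facts [simp]:
  assumes "X \<in> Ob C"
  shows "iso_mor C (piv C X)" "piv C X \<in> Mor C" "Dom C (piv C X) = X"
    "Cod C (piv C X) = dual C (dual C X)"
proof -
  have "natural_iso C C id id (dual C \<circ> dual C) (dual_mor C \<circ> dual_mor C) (piv C)"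
    using pivotal unfolding monoidal_natural_iso_def by (rule conjunct1)
  then have "\<forall>X\<in>Ob C. piv C X \<in> Hom C (id X) ((dual C \<circ> dual C) X) \<and> iso_mor C (piv C X)"
    unfolding natural_iso_def by (rule conjunct1)
  from bspec[OF this assms] show "iso_mor C (piv C X)" "piv C X \<in> Mor C" "Dom C (piv C X) = X"
    "Cod C (piv C X) = dual C (dual C X)"
    by (simp_all add: Hom_iff)
qed

section \<open>Tensor powers, the indicator operator and scalars\<close>

context pivotal_fusion_category
begin

text \<open>The clause for exponent 1 fits this recursion because the unit is strict; inductions
  over powers can then start at 0.\<close>

lemma tpow_Suc: "V \<in> Ob C \<Longrightarrow> tpow C V (Suc n) = V \<otimes>\<^sub>o tpow C V n"
  by (cases n) auto

lemma tpow_Ob [simp]: "V \<in> Ob C \<Longrightarrow> tpow C V n \<in> Ob C"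
  by (induction n) (auto simp: tpow_Suc)

lemma tpow_assoc_simps [simp]:
  assumes "V \<in> Ob C"
  shows "tpow_assoc C V (Suc n) \<in> Mor C" "Dom C (tpow_assoc C V (Suc n)) = tpow C V n \<otimes>\<^sub>o V"
    "Cod C (tpow_assoc C V (Suc n)) = tpow C V (Suc n)"
proof -
  have "tpow_assoc C V (Suc n) \<in> Hom C (tpow C V n \<otimes>\<^sub>o V) (tpow C V (Suc n))"
  proof (induction n)
    case 0
    show ?case using assms by (simp add: Hom_iff)
  next
    case (Suc n)
    show ?case
    proof (cases n)
      case 0
      then show ?thesis using assms by (simp add: Hom_iff)
    next
      case (Suc k)
      have "tpow_assoc C V (Suc n) \<in> Mor C" "Dom C (tpow_assoc C V (Suc n)) = tpow C V n \<otimes>\<^sub>o V"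
        "Cod C (tpow_assoc C V (Suc n)) = tpow C V (Suc n)"
        using Suc.IH by (simp_all only: Hom_iff)
      then show ?thesis using assms Suc by (simp add: Hom_iff)
    qed
  qed
  then show "tpow_assoc C V (Suc n) \<in> Mor C" "Dom C (tpow_assoc C V (Suc n)) = tpow C V n \<otimes>\<^sub>o V"
    "Cod C (tpow_assoc C V (Suc n)) = tpow C V (Suc n)" by (simp_all only: Hom_iff)
qed

lemma cmp_linear:
  assumes "T \<in> linear_maps U (hom_space C X Y)" "g \<in> Hom C Y Z"
  shows "(\<lambda>f. g \<cdot> T f) \<in> linear_maps U (hom_space C X Z)"
proof (cases "X \<in> Ob C")
  case True
  show ?thesis using linear_maps_comp[OF assms(1) cmp_linear_right[OF True assms(2)]] .
next
  \<comment> \<open>If \<open>X\<close> is no object, \<open>Hom C X Y\<close> is empty, hence so is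
    the carrier of \<open>U\<close>, and the claim is vacuous.\<close>
  case False
  then show ?thesis using assms
    by (auto simp: LinearCombinations.module_hom_def Hom_iff Pi_iff)
qed

text \<open>The operator is a chain of tensor products and compositions with fixed morphisms; the
  numbered facts follow it outwards from \<open>f\<close>.\<close>

lemma fs_E_linear:
  assumes V: "V \<in> Ob C"
  shows "fs_E C (Suc m) V \<in> linear_maps (hom_space C \<^bold>1 (tpow C V (Suc m))) (hom_space C \<^bold>1 (tpow C V (Suc m)))"
proof -
  let ?U = "tpow C V m" and ?V' = "dual C V" and ?V'' = "dual C (dual C V)"
  have 1: "(\<lambda>f. \<iota> ?V' \<otimes>\<^sub>m f) \<in> linear_maps (hom_space C \<^bold>1 (tpow C V (Suc m))) (hom_space C ?V' (?V' \<otimes>\<^sub>o V \<otimes>\<^sub>o ?U))"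
    using tens_linear_right[of "\<iota> ?V'" ?V' ?V' "\<^bold>1" "tpow C V (Suc m)"] V by (simp add: Hom_iff tpow_Suc)
  have 2: "(\<lambda>f. minv C (\<a> ?V' V ?U) \<cdot> (\<iota> ?V' \<otimes>\<^sub>m f)) \<in> linear_maps (hom_space C \<^bold>1 (tpow C V (Suc m))) (hom_space C ?V' ((?V' \<otimes>\<^sub>o V) \<otimes>\<^sub>o ?U))"
    by (rule cmp_linear[OF 1]) (use V in \<open>simp add: Hom_iff\<close>)
  have 3: "(\<lambda>f. (ev C V \<otimes>\<^sub>m \<iota> ?U) \<cdot> minv C (\<a> ?V' V ?U) \<cdot> (\<iota> ?V' \<otimes>\<^sub>m f)) \<in> linear_maps (hom_space C \<^bold>1 (tpow C V (Suc m))) (hom_space C ?V' ?U)"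
    by (rule cmp_linear[OF 2]) (use V in \<open>simp add: Hom_iff\<close>)
  have 4: "(\<lambda>f. ((ev C V \<otimes>\<^sub>m \<iota> ?U) \<cdot> minv C (\<a> ?V' V ?U) \<cdot> (\<iota> ?V' \<otimes>\<^sub>m f)) \<otimes>\<^sub>m \<iota> ?V'')
    \<in> linear_maps (hom_space C \<^bold>1 (tpow C V (Suc m))) (hom_space C (?V' \<otimes>\<^sub>o ?V'') (?U \<otimes>\<^sub>o ?V''))"
    by (rule linear_maps_comp[OF 3 tens_linear_left]) (use V in \<open>simp_all add: Hom_iff\<close>)
  have 5: "fs_D C V ?U \<in> linear_maps (hom_space C \<^bold>1 (tpow C V (Suc m))) (hom_space C \<^bold>1 (?U \<otimes>\<^sub>o ?V''))"
    unfolding fs_D_def Let_def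
    by (rule linear_maps_comp[OF 4 cmp_linear_left]) (use V in \<open>simp_all add: Hom_iff\<close>)
  have 6: "(\<lambda>f. (\<iota> ?U \<otimes>\<^sub>m minv C (piv C V)) \<cdot> fs_D C V ?U f) \<in> linear_maps (hom_space C \<^bold>1 (tpow C V (Suc m))) (hom_space C \<^bold>1 (?U \<otimes>\<^sub>o V))"
    by (rule cmp_linear[OF 5]) (use V in \<open>simp add: Hom_iff\<close>)
  show ?thesis unfolding fs_E_def diff_Suc_1
    by (rule cmp_linear[OF 6]) (use V in \<open>simp add: Hom_iff\<close>)
qed

lemma scalar_of_scale [simp]: "scalar_of C (mscale C c (\<iota> \<^bold>1)) = c"
proof -
  have "inj (\<lambda>c. mscale C c (\<iota> \<^bold>1))"
    using End_simple[OF unit_simple] by (simp add: bij_betw_def)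
  then show ?thesis unfolding scalar_of_def by (intro the_equality) (auto dest: injD)
qed

lemma End_unit:
  assumes "f \<in> Hom C \<^bold>1 \<^bold>1"
  shows "f = mscale C (scalar_of C f) (\<iota> \<^bold>1)"
proof -
  have "f \<in> range (\<lambda>c. mscale C c (\<iota> \<^bold>1))"
    using End_simple[OF unit_simple] assms by (simp add: bij_betw_def)
  then show ?thesis by auto
qed

text \<open>Schur's lemma: \<open>minv C g \<cdot> f\<close> is an endomorphism of a simple object,
  hence a scalar. If the scalar were zero, \<open>f\<close> and with it the identity of
  \<open>V\<close> would vanish.\<close>

lemma iso_proportional:
  assumes simple: "is_simple C V" and f: "f \<in> Hom C V X" "iso_mor C f" and g: "g \<in> Hom C V X" "iso_mor C g"
  obtains c where "c \<noteq> 0" "f = mscale C c g"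
proof -
  have V: "V \<in> Ob C" "\<iota> V \<noteq> mzero C V V" using simple by (auto simp: is_simple_def)
  have "minv C g \<cdot> f \<in> Hom C V V" using f g by (auto simp: Hom_iff)
  then have "minv C g \<cdot> f \<in> range (\<lambda>c. mscale C c (\<iota> V))"
    using End_simple[OF simple] by (simp add: bij_betw_def)
  then obtain c where c: "minv C g \<cdot> f = mscale C c (\<iota> V)" by auto
  have "f = g \<cdot> (minv C g \<cdot> f)" using f g by (auto simp: Hom_iff)
  then have "f = mscale C c g" unfolding c using g V by (auto simp: Hom_iff)
  moreover have "c \<noteq> 0"
  proof
    assume "c = 0"
    then have "f = mzero C V X" using \<open>f = mscale C c g\<close> g by (auto simp: Hom_iff)
    then have "minv C f \<cdot> mzero C V X = \<iota> V" using f by (metis Hom_iff mem_Collect_eq minv_simps(4))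
    then show False using V f by (auto simp: cmp_zero Hom_iff)
  qed
  ultimately show ?thesis using that by blast
qed

end

lemma (in lin_category) minv_scale:
  assumes "iso_mor C f" "c \<noteq> 0"
  shows "iso_mor C (mscale C c f)" "minv C (mscale C c f) = mscale C (1 / c) (minv C f)"
proof -
  have "mutually_inverse C (mscale C c f) (mscale C (1 / c) (minv C f))"
    using assms by (simp add: mutually_inverse_def Hom_iff)
  then show "iso_mor C (mscale C c f)" "minv C (mscale C c f) = mscale C (1 / c) (minv C f)"
    using minv_eqI by (auto simp: iso_mor_def)
qed

section \<open>Transport of tensor powers, indicators and dimensions\<close>

locale pivotal_comparison = source: pivotal_fusion_category C + target: pivotal_fusion_category D +
    monoidal_functor C D Fo Fm F2 F0 + lin_equivalence C D Fo Fm
  for C :: "('o, 'm, 'y) piv_cat_scheme" and D :: "('p, 'q, 'z) piv_cat_scheme"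
    and Fo Fm F2 F0
begin

text \<open>The tensor power of \<open>t\<close> in the comma category. For t : W \<rightarrow> F V
  it leads from the power of W to \<open>F\<close> of the power of V; its clauses mirror those of
  \<open>tpow\<close>.\<close>

fun tpow_over :: "'o \<Rightarrow> 'q \<Rightarrow> nat \<Rightarrow> 'q" where
  "tpow_over V t 0 = F0"
| "tpow_over V t (Suc 0) = t"
| "tpow_over V t (Suc (Suc n)) = join V (tpow C V (Suc n)) t (tpow_over V t (Suc n))"

lemma tpow_over_Suc: "over V t \<Longrightarrow> tpow_over V t (Suc n) = join V (tpow C V n) t (tpow_over V t n)"
  by (cases n) auto

end

text \<open>Carrying \<open>t\<close> along, instead of taking \<open>W\<close> to be
  \<open>Fo V\<close>, makes room for an independently chosen representative of the class of
  \<open>Fo V\<close>.\<close>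

locale over_object = pivotal_comparison +
  fixes V W t
  assumes t [simp]: "over V t" "iso_mor D t" "Dom D t = W"
begin

lemma t_obs [simp]: "V \<in> Ob C" "W \<in> Ob D" "t \<in> Mor D" "Cod D t = Fo V"
  using over_simps[OF t(1)] target.mor_obs(1)[of t] by auto

lemma over_tpow [simp]:
  "over (tpow C V n) (tpow_over V t n)" "iso_mor D (tpow_over V t n)"
  "Dom D (tpow_over V t n) = tpow D W n"
proof -
  have "over (tpow C V n) (tpow_over V t n) \<and> iso_mor D (tpow_over V t n) \<and>
    Dom D (tpow_over V t n) = tpow D W n"
    by (induction n) (auto simp: source.tpow_Suc target.tpow_Suc tpow_over_Suc)
  then show "over (tpow C V n) (tpow_over V t n)" "iso_mor D (tpow_over V t n)"
    "Dom D (tpow_over V t n) = tpow D W n" by auto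
qed

text \<open>Only associators and identities enter the recursion of \<open>tpow_assoc\<close>, and
  these are squares. Exponent 2 has its own clause there and therefore its own case here.\<close>

lemma square_tpow_assoc:
  "square (tpow C V n \<otimes>\<^sub>o\<^bsub>C\<^esub> V) (join (tpow C V n) V (tpow_over V t n) t)
    (tpow C V (Suc n)) (tpow_over V t (Suc n)) (tpow_assoc C V (Suc n)) (tpow_assoc D W (Suc n))"
proof (induction n)
  case 0
  then show ?case using square_idt[OF t(1,3)] by simp
next
  case (Suc n)
  show ?case
  proof (cases n)
    case 0
    then show ?thesis using square_idt[of "V \<otimes>\<^sub>o\<^bsub>C\<^esub> V" "join V V t t" "W \<otimes>\<^sub>o\<^bsub>D\<^esub> W"] by simp
  next
    case (Suc k)
    have "square ((V \<otimes>\<^sub>o\<^bsub>C\<^esub> tpow C V n) \<otimes>\<^sub>o\<^bsub>C\<^esub> V) (join (V \<otimes>\<^sub>o\<^bsub>C\<^esub> tpow C V n) V (join V (tpow C V n) t (tpow_over V t n)) t)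
      (V \<otimes>\<^sub>o\<^bsub>C\<^esub> tpow C V (Suc n)) (join V (tpow C V (Suc n)) t (tpow_over V t (Suc n)))
      ((\<iota>\<^bsub>C\<^esub> V \<otimes>\<^sub>m\<^bsub>C\<^esub> tpow_assoc C V (Suc n)) \<cdot>\<^bsub>C\<^esub> \<a>\<^bsub>C\<^esub> V (tpow C V n) V)
      ((\<iota>\<^bsub>D\<^esub> W \<otimes>\<^sub>m\<^bsub>D\<^esub> tpow_assoc D W (Suc n)) \<cdot>\<^bsub>D\<^esub> \<a>\<^bsub>D\<^esub> W (tpow D W n) W)"
      using square_assoc[of V t "tpow C V n" "tpow_over V t n" V t]
      by (intro square_cmp[OF square_tens[OF square_idt[OF t(1,3)] Suc.IH]]) simp
    then show ?thesis using Suc by simp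
  qed
qed

end

text \<open>
  The morphisms \<open>s : W* \<rightarrow> F V*\<close> and \<open>r : W** \<rightarrow> F V**\<close> transport the duality data.  The two pivotal
  structures are unrelated, so they need only agree up to a scalar \<open>c\<close> at \<open>V\<close>.
\<close>

locale dual_comparison = over_object +
  fixes s r c
  assumes s [simp]: "over (dual C V) s" "iso_mor D s" "Dom D s = dual D W"
    and ev: "square (dual C V \<otimes>\<^sub>o\<^bsub>C\<^esub> V) (join (dual C V) V s t) \<^bold>1\<^bsub>C\<^esub> F0 (ev C V) (ev D W)"
    and coev: "square \<^bold>1\<^bsub>C\<^esub> F0 (V \<otimes>\<^sub>o\<^bsub>C\<^esub> dual C V) (join V (dual C V) t s) (coev C V) (coev D W)"
    and r [simp]: "over (dual C (dual C V)) r" "iso_mor D r" "Dom D r = dual D (dual D W)"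
    and ev': "square (dual C (dual C V) \<otimes>\<^sub>o\<^bsub>C\<^esub> dual C V) (join (dual C (dual C V)) (dual C V) r s) \<^bold>1\<^bsub>C\<^esub> F0
      (ev C (dual C V)) (ev D (dual D W))"
    and coev': "square \<^bold>1\<^bsub>C\<^esub> F0 (dual C V \<otimes>\<^sub>o\<^bsub>C\<^esub> dual C (dual C V)) (join (dual C V) (dual C (dual C V)) s r)
      (coev C (dual C V)) (coev D (dual D W))"
    and c [simp]: "c \<noteq> 0"
    and piv: "square V t (dual C (dual C V)) r (mscale C c (piv C V)) (piv D W)"
begin

lemma s_r_simps [simp]: "Cod D s = Fo (dual C V)" "r \<in> Mor D" "Cod D r = Fo (dual C (dual C V))"
  using over_simps[OF s(1)] over_simps[OF r(1)] by auto

text \<open>All ingredients of \<open>fs_D\<close> are squares already, with \<open>s\<close> and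
  \<open>r\<close> as the objects over the dual and the double dual.\<close>

lemma square_fs_D:
  assumes u: "over U u" "Dom D u = A" and f: "square \<^bold>1\<^bsub>C\<^esub> F0 (V \<otimes>\<^sub>o\<^bsub>C\<^esub> U) (join V U t u) f f'"
  shows "square \<^bold>1\<^bsub>C\<^esub> F0 (U \<otimes>\<^sub>o\<^bsub>C\<^esub> dual C (dual C V)) (join U (dual C (dual C V)) u r)
    (fs_D C V U f) (fs_D D W A f')"
proof -
  note [simp] = over_simps[OF u(1)] u
  have "square (dual C V \<otimes>\<^sub>o\<^bsub>C\<^esub> \<^bold>1\<^bsub>C\<^esub>) (join (dual C V) \<^bold>1\<^bsub>C\<^esub> s F0) (\<^bold>1\<^bsub>C\<^esub> \<otimes>\<^sub>o\<^bsub>C\<^esub> U) (join \<^bold>1\<^bsub>C\<^esub> U F0 u)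
    ((ev C V \<otimes>\<^sub>m\<^bsub>C\<^esub> \<iota>\<^bsub>C\<^esub> U) \<cdot>\<^bsub>C\<^esub> minv C (\<a>\<^bsub>C\<^esub> (dual C V) V U) \<cdot>\<^bsub>C\<^esub> (\<iota>\<^bsub>C\<^esub> (dual C V) \<otimes>\<^sub>m\<^bsub>C\<^esub> f))
    ((ev D W \<otimes>\<^sub>m\<^bsub>D\<^esub> \<iota>\<^bsub>D\<^esub> A) \<cdot>\<^bsub>D\<^esub> minv D (\<a>\<^bsub>D\<^esub> (Dom D s) (Dom D t) (Dom D u)) \<cdot>\<^bsub>D\<^esub> (\<iota>\<^bsub>D\<^esub> (Dom D s) \<otimes>\<^sub>m\<^bsub>D\<^esub> f'))"
    by (rule f ev square_assoc_inv square_idt square_tens square_cmp s t u refl)+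
  then have 1: "square (dual C V) s U u
    ((ev C V \<otimes>\<^sub>m\<^bsub>C\<^esub> \<iota>\<^bsub>C\<^esub> U) \<cdot>\<^bsub>C\<^esub> minv C (\<a>\<^bsub>C\<^esub> (dual C V) V U) \<cdot>\<^bsub>C\<^esub> (\<iota>\<^bsub>C\<^esub> (dual C V) \<otimes>\<^sub>m\<^bsub>C\<^esub> f))
    ((ev D W \<otimes>\<^sub>m\<^bsub>D\<^esub> \<iota>\<^bsub>D\<^esub> A) \<cdot>\<^bsub>D\<^esub> minv D (\<a>\<^bsub>D\<^esub> (dual D W) W A) \<cdot>\<^bsub>D\<^esub> (\<iota>\<^bsub>D\<^esub> (dual D W) \<otimes>\<^sub>m\<^bsub>D\<^esub> f'))"
    by simp
  show ?thesis unfolding fs_D_def Let_def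
    by (rule square_cmp[OF square_tens[OF 1 square_idt[OF r(1,3)]] coev'])
qed

text \<open>The operator contains the inverse of the pivotal morphism exactly once; the factor
  \<open>c\<close> in the square \<open>piv\<close> thus becomes \<open>1 / c\<close> and moves to
  the front.\<close>

lemma square_fs_E:
  assumes f: "square \<^bold>1\<^bsub>C\<^esub> F0 (tpow C V (Suc m)) (tpow_over V t (Suc m)) f f'"
  shows "square \<^bold>1\<^bsub>C\<^esub> F0 (tpow C V (Suc m)) (tpow_over V t (Suc m))
    (mscale C (1 / c) (fs_E C (Suc m) V f)) (fs_E D (Suc m) W f')"
proof -
  have 1: "square (dual C (dual C V)) r V t (mscale C (1 / c) (minv C (piv C V))) (minv D (piv D W))"
    using square_minv[OF piv] source.minv_scale[of "piv C V" c] by simp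
  have 2: "square \<^bold>1\<^bsub>C\<^esub> F0 (tpow C V m \<otimes>\<^sub>o\<^bsub>C\<^esub> dual C (dual C V))
    (join (tpow C V m) (dual C (dual C V)) (tpow_over V t m) r)
    (fs_D C V (tpow C V m) f) (fs_D D W (tpow D W m) f')"
    using f by (intro square_fs_D) (simp_all add: source.tpow_Suc tpow_over_Suc)
  have "square \<^bold>1\<^bsub>C\<^esub> F0 (tpow C V (Suc m)) (tpow_over V t (Suc m))
    (tpow_assoc C V (Suc m) \<cdot>\<^bsub>C\<^esub> (\<iota>\<^bsub>C\<^esub> (tpow C V m) \<otimes>\<^sub>m\<^bsub>C\<^esub> mscale C (1 / c) (minv C (piv C V))) \<cdot>\<^bsub>C\<^esub> fs_D C V (tpow C V m) f)
    (tpow_assoc D W (Suc m) \<cdot>\<^bsub>D\<^esub> (\<iota>\<^bsub>D\<^esub> (tpow D W m) \<otimes>\<^sub>m\<^bsub>D\<^esub> minv D (piv D W)) \<cdot>\<^bsub>D\<^esub> fs_D D W (tpow D W m) f')"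
    by (rule square_tpow_assoc square_cmp square_tens 1 2 square_idt over_tpow)+
  then show ?thesis unfolding fs_E_def using squareD[OF 2] by simp
qed

lemma fs_indicator_transport:
  assumes "n \<ge> 1"
  shows "fs_indicator D n W = (1 / c) * fs_indicator C n V"
proof -
  obtain m where n: "n = Suc m" using assms by (cases n) auto
  let ?X = "tpow C V n" and ?x = "tpow_over V t n" and ?Y = "tpow D W n"
  \<comment> \<open>\<open>P f\<close> is the only morphism that completes a square over
    \<open>f\<close> from \<open>F0\<close> to \<open>?x\<close>.\<close>
  define P where "P f = minv D ?x \<cdot>\<^bsub>D\<^esub> Fm f \<cdot>\<^bsub>D\<^esub> F0" for f
  have sq: "square \<^bold>1\<^bsub>C\<^esub> F0 ?X ?x f (P f)" if "f \<in> Hom C \<^bold>1\<^bsub>C\<^esub> ?X" for f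
    unfolding P_def by (rule square_fill[OF over_F0 over_tpow(1,2) that])
  have P_Hom: "P f \<in> Hom D \<^bold>1\<^bsub>D\<^esub> ?Y" if "f \<in> Hom C \<^bold>1\<^bsub>C\<^esub> ?X" for f
    using squareD[OF sq[OF that]] by (simp add: Hom_iff)
  have P: "P \<in> linear_maps (hom_space C \<^bold>1\<^bsub>C\<^esub> ?X) (hom_space D \<^bold>1\<^bsub>D\<^esub> ?Y)"
    unfolding P_def
    by (rule target.cmp_linear[OF linear_maps_comp[OF F_linear target.cmp_linear_left]])
      (simp_all add: Hom_iff over_simps[OF over_tpow(1)])
  have inj: "inj_on P (Hom C \<^bold>1\<^bsub>C\<^esub> ?X)"
  proof (rule inj_onI)
    fix f g assume f: "f \<in> Hom C \<^bold>1\<^bsub>C\<^esub> ?X" and g: "g \<in> Hom C \<^bold>1\<^bsub>C\<^esub> ?X" and "P f = P g"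
    then have "Fm f \<cdot>\<^bsub>D\<^esub> F0 = Fm g \<cdot>\<^bsub>D\<^esub> F0" using square_eq[OF sq[OF f]] square_eq[OF sq[OF g]] by simp
    then have "(Fm f \<cdot>\<^bsub>D\<^esub> F0) \<cdot>\<^bsub>D\<^esub> minv D F0 = (Fm g \<cdot>\<^bsub>D\<^esub> F0) \<cdot>\<^bsub>D\<^esub> minv D F0" by simp
    then show "f = g" using f g by (intro faithful[OF f g]) (simp add: target.assoc_cmp Hom_iff)
  qed
  have surj: "\<exists>f \<in> Hom C \<^bold>1\<^bsub>C\<^esub> ?X. P f = g" if g: "g \<in> Hom D \<^bold>1\<^bsub>D\<^esub> ?Y" for g
  proof -
    have [simp]: "Cod D ?x = Fo ?X" by (rule over_simps[OF over_tpow(1)])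
    \<comment> \<open>The morphism to be lifted comes from solving \<open>P f = g\<close> for
      \<open>Fm f\<close>.\<close>
    obtain f where f: "f \<in> Hom C \<^bold>1\<^bsub>C\<^esub> ?X" "Fm f = (?x \<cdot>\<^bsub>D\<^esub> g) \<cdot>\<^bsub>D\<^esub> minv D F0"
      by (rule full[of "\<^bold>1\<^bsub>C\<^esub>" ?X "(?x \<cdot>\<^bsub>D\<^esub> g) \<cdot>\<^bsub>D\<^esub> minv D F0"]) (use g in \<open>auto simp: Hom_iff\<close>)
    then have "P f = g" using g by (simp add: P_def target.assoc_cmp Hom_iff)
    with f show ?thesis by blast
  qed
  have bij: "bij_betw P (Hom C \<^bold>1\<^bsub>C\<^esub> ?X) (Hom D \<^bold>1\<^bsub>D\<^esub> ?Y)"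
    using inj surj P_Hom by (force simp: bij_betw_def)
  have conj: "fs_E D n W (P f) = mscale D (1 / c) (P (fs_E C n V f))" if f: "f \<in> Hom C \<^bold>1\<^bsub>C\<^esub> ?X" for f
  proof -
    have E: "fs_E C n V f \<in> Hom C \<^bold>1\<^bsub>C\<^esub> ?X"
      using source.fs_E_linear[OF t_obs(1), of m] f by (simp add: n linear_maps_iff)
    have "square \<^bold>1\<^bsub>C\<^esub> F0 ?X ?x (mscale C (1 / c) (fs_E C n V f)) (fs_E D n W (P f))"
      using square_fs_E sq[OF f] unfolding n .
    moreover have "square \<^bold>1\<^bsub>C\<^esub> F0 ?X ?x (mscale C (1 / c) (fs_E C n V f)) (P (mscale C (1 / c) (fs_E C n V f)))"
      by (rule sq) (use E in \<open>simp add: Hom_iff\<close>)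
    \<comment> \<open>Both sides complete a square over the same morphism of
      \<open>C\<close>.\<close>
    ultimately have "fs_E D n W (P f) = P (mscale C (1 / c) (fs_E C n V f))"
      by (rule square_unique) simp
    also have "\<dots> = mscale D (1 / c) (P (fs_E C n V f))"
      using P E by (simp add: linear_maps_iff)
    finally show ?thesis .
  qed
  show ?thesis unfolding fs_indicator_def
  proof (rule lin_trace_conjugate[where P = P])
    show "fs_E C n V \<in> linear_maps (hom_space C \<^bold>1\<^bsub>C\<^esub> ?X) (hom_space C \<^bold>1\<^bsub>C\<^esub> ?X)"
      unfolding n by (rule source.fs_E_linear) simp
  qed (use P bij conj in \<open>simp_all add: source.hom_vectorspace target.hom_vectorspace
      source.hom_fin_dim target.hom_fin_dim\<close>)
qed

text \<open>The composite defining the dimension is linear in the pivotal morphism and is a scalar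
  endomorphism of the unit. Linearity of \<open>F\<close> makes the same scalar in \<open>D\<close>
  complete the square, and \<open>square_unique\<close> identifies it.\<close>

lemma pdim_transport: "pdim D W = c * pdim C V"
proof -
  let ?p = "\<lambda>j. ev C (dual C V) \<cdot>\<^bsub>C\<^esub> (j \<otimes>\<^sub>m\<^bsub>C\<^esub> \<iota>\<^bsub>C\<^esub> (dual C V)) \<cdot>\<^bsub>C\<^esub> coev C V"
  let ?q = "ev D (dual D W) \<cdot>\<^bsub>D\<^esub> (piv D W \<otimes>\<^sub>m\<^bsub>D\<^esub> \<iota>\<^bsub>D\<^esub> (dual D W)) \<cdot>\<^bsub>D\<^esub> coev D W"
  have "?p (piv C V) = mscale C (pdim C V) (\<iota>\<^bsub>C\<^esub> \<^bold>1\<^bsub>C\<^esub>)"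
    unfolding pdim_def by (rule source.End_unit) (simp add: Hom_iff)
  then have p: "?p (mscale C c (piv C V)) = mscale C (c * pdim C V) (\<iota>\<^bsub>C\<^esub> \<^bold>1\<^bsub>C\<^esub>)"
    by simp
  have "square \<^bold>1\<^bsub>C\<^esub> F0 \<^bold>1\<^bsub>C\<^esub> F0 (?p (mscale C c (piv C V))) ?q"
    by (rule ev' piv coev square_idt square_tens square_cmp s)+
  moreover have "square \<^bold>1\<^bsub>C\<^esub> F0 \<^bold>1\<^bsub>C\<^esub> F0 (?p (mscale C c (piv C V))) (mscale D (c * pdim C V) (\<iota>\<^bsub>D\<^esub> \<^bold>1\<^bsub>D\<^esub>))"
    unfolding p by (simp add: square_def Hom_iff)
  ultimately have "?q = mscale D (c * pdim C V) (\<iota>\<^bsub>D\<^esub> \<^bold>1\<^bsub>D\<^esub>)"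
    by (rule square_unique) simp
  then show ?thesis unfolding pdim_def[of D] by simp
qed

end

context over_object
begin

text \<open>The factors \<open>1 / c\<close> and \<open>c\<close> cancel. \<open>dual_over\<close>
  is applied twice, the second time starting from \<open>s\<close>, so that the data for the double
  dual refer to the dual already chosen.\<close>

lemma indicator_pdim_transport:
  assumes simple: "is_simple D W" and n: "n \<ge> 1"
  shows "fs_indicator D n W * pdim D W = fs_indicator C n V * pdim C V"
proof -
  obtain s where s: "over (dual C V) s" "iso_mor D s" "Dom D s = dual D W"
    "square (dual C V \<otimes>\<^sub>o\<^bsub>C\<^esub> V) (join (dual C V) V s t) \<^bold>1\<^bsub>C\<^esub> F0 (ev C V) (ev D W)"
    "square \<^bold>1\<^bsub>C\<^esub> F0 (V \<otimes>\<^sub>o\<^bsub>C\<^esub> dual C V) (join V (dual C V) t s) (coev C V) (coev D W)"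
    by (rule dual_over[OF source.chosen_left_dual target.chosen_left_dual t]) simp_all
  obtain r where r: "over (dual C (dual C V)) r" "iso_mor D r" "Dom D r = dual D (dual D W)"
    "square (dual C (dual C V) \<otimes>\<^sub>o\<^bsub>C\<^esub> dual C V) (join (dual C (dual C V)) (dual C V) r s) \<^bold>1\<^bsub>C\<^esub> F0
      (ev C (dual C V)) (ev D (dual D W))"
    "square \<^bold>1\<^bsub>C\<^esub> F0 (dual C V \<otimes>\<^sub>o\<^bsub>C\<^esub> dual C (dual C V)) (join (dual C V) (dual C (dual C V)) s r)
      (coev C (dual C V)) (coev D (dual D W))"
    by (rule dual_over[OF source.chosen_left_dual target.chosen_left_dual s(1-3)]) simp_all
  note [simp] = over_simps[OF s(1)] over_simps[OF r(1)] r(2,3)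
  \<comment> \<open>Both morphisms are isomorphisms from the simple object \<open>W\<close> to
    \<open>Fo (dual C (dual C V))\<close>, one through the pivotal structure of \<open>D\<close>,
    the other through that of \<open>C\<close>.\<close>
  obtain c where c: "c \<noteq> 0" "r \<cdot>\<^bsub>D\<^esub> piv D W = mscale D c (Fm (piv C V) \<cdot>\<^bsub>D\<^esub> t)"
    by (rule target.iso_proportional[OF simple, of "r \<cdot>\<^bsub>D\<^esub> piv D W" "Fo (dual C (dual C V))" "Fm (piv C V) \<cdot>\<^bsub>D\<^esub> t"])
      (auto simp: Hom_iff)
  have piv: "square V t (dual C (dual C V)) r (mscale C c (piv C V)) (piv D W)"
    using c r(1) by (simp add: square_def Hom_iff)
  interpret dual_comparison C D Fo Fm F2 F0 V W t s r c
    by unfold_locales (fact s r c piv)+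
  show ?thesis using fs_indicator_transport[OF n] pdim_transport c(1) by simp
qed

end

section \<open>Matching the sums over simple objects\<close>

theorem theorem3p1:
  fixes C :: "('o, 'm) piv_cat" and D :: "('p, 'q) piv_cat"
    and Irr_C :: "'o set" and Irr_D :: "'p set" and n :: nat
  assumes "pivotal_fusion_category C" and "pivotal_fusion_category D"
    and "irr_representatives C Irr_C" and "irr_representatives D Irr_D"
    and "monoidally_equivalent C D"
    and "n \<ge> 1"
  shows "fs_indicator_cat C Irr_C n = fs_indicator_cat D Irr_D n"
proof -
  obtain Fo Fm F2 F0 where F: "monoidal_functor C D Fo Fm F2 F0" and equiv: "is_equivalence C D Fo Fm"
    using assms(5) by (auto simp: monoidally_equivalent_def)
  interpret pivotal_comparison C D Fo Fm F2 F0
    using assms(1,2) F equiv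
    by (simp add: pivotal_comparison_def lin_equivalence_def lin_equivalence_axioms_def is_equivalence_def)
  obtain Go Gm where G: "is_equivalence D C Go Gm" and FG: "\<And>Y. Y \<in> Ob D \<Longrightarrow> isomorphic D (Fo (Go Y)) Y"
    using equivalence_inverse[OF equiv] by metis
  have C: "is_simple C V" if "V \<in> Irr_C" for V
    using assms(3) that by (simp add: irr_representatives_def)
  have D: "is_simple D W" if "W \<in> Irr_D" for W
    using assms(4) that by (simp add: irr_representatives_def)
  have Ob: "V \<in> Ob C" if "V \<in> Irr_C" for V using C[OF that] by (simp add: is_simple_def)
  have exC: "\<exists>!V'. V' \<in> Irr_C \<and> isomorphic C V V'" if "is_simple C V" for V
    using assms(3) that by (simp add: irr_representatives_def)
  have exD: "\<exists>!W'. W' \<in> Irr_D \<and> isomorphic D W W'" if "is_simple D W" for W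
    using assms(4) that by (simp add: irr_representatives_def)
  \<comment> \<open>The representative in \<open>Irr_D\<close> of the class of \<open>Fo V\<close>;
    the two sums are matched along this map.\<close>
  define \<phi> where "\<phi> V = (THE W. W \<in> Irr_D \<and> isomorphic D (Fo V) W)" for V
  have \<phi>: "\<phi> V \<in> Irr_D" "isomorphic D (Fo V) (\<phi> V)" if "V \<in> Irr_C" for V
    using theI'[OF exD[OF equivalence_preserves_simple[OF equiv C[OF that]]]] by (auto simp: \<phi>_def)
  have inj: "inj_on \<phi> Irr_C"
  proof (rule inj_onI)
    fix V V' assume V: "V \<in> Irr_C" "V' \<in> Irr_C" "\<phi> V = \<phi> V'"
    then have "isomorphic D (Fo V) (Fo V')"
      using \<phi> target.isomorphic_sym target.isomorphic_trans by metis
    then have "isomorphic C V V'" by (rule reflects_isomorphic[OF Ob Ob, OF V(1,2)])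
    moreover have "isomorphic C V V"
      unfolding isomorphic_def using Ob[OF V(1)] by (intro bexI[of _ "\<iota>\<^bsub>C\<^esub> V"]) (auto simp: Hom_iff)
    ultimately show "V = V'" using exC[OF C[OF V(1)]] V by auto
  qed
  have surj: "W \<in> \<phi> ` Irr_C" if W: "W \<in> Irr_D" for W
  proof -
    \<comment> \<open>The preimage is found with the quasi-inverse, as the representative of
      \<open>Go W\<close>.\<close>
    obtain V where V: "V \<in> Irr_C" "isomorphic C (Go W) V"
      using exC[OF equivalence_preserves_simple[OF G D[OF W]]] by auto
    have "isomorphic D (Fo V) W"
      using F_isomorphic[OF V(2)] FG[of W] D[OF W] target.isomorphic_sym target.isomorphic_trans
      by (metis is_simple_def)
    then have "\<phi> V = W"
      using exD[OF equivalence_preserves_simple[OF equiv C[OF V(1)]]] \<phi>[OF V(1)] W by blast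
    then show ?thesis using V by blast
  qed
  have "bij_betw \<phi> Irr_C Irr_D" using inj surj \<phi> by (auto simp: bij_betw_def)
  then have "fs_indicator_cat D Irr_D n = (\<Sum>V\<in>Irr_C. fs_indicator D n (\<phi> V) * pdim D (\<phi> V))"
    unfolding fs_indicator_cat_def by (rule sum.reindex_bij_betw[symmetric])
  also have "\<dots> = fs_indicator_cat C Irr_C n"
    unfolding fs_indicator_cat_def
  proof (rule sum.cong[OF refl])
    fix V assume V: "V \<in> Irr_C"
    \<comment> \<open>Objects of the comma category point towards \<open>Fo V\<close>, hence the
      reversed isomorphism.\<close>
    obtain t where t: "t \<in> Hom D (\<phi> V) (Fo V)" "iso_mor D t"
      using target.isomorphic_sym[OF \<phi>(2)[OF V]] by (auto simp: isomorphic_def)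
    interpret over_object C D Fo Fm F2 F0 V "\<phi> V" t
      using t Ob[OF V] by unfold_locales (simp_all add: over_def Hom_iff)
    show "fs_indicator D n (\<phi> V) * pdim D (\<phi> V) = fs_indicator C n V * pdim C V"
      by (rule indicator_pdim_transport[OF D[OF \<phi>(1)[OF V]] assms(6)])
  qed
  finally show ?thesis by simp
qed

end
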